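(* Let $d$ and $k$ be integers with $0\leq k\leq d-1$. For $i=0,1,\ldots,k$ let $\Delta_i$ be a $(d-k+1)$-dimensional simplex with vertices $e^i_0,e^i_1,\ldots,e^i_{d-k+1}$, and let $\varphi_i:\Delta_i\to\mathbb{R}^d$ be a continuous mapping. Then there is an affine $k$-flat $F$ in $\mathbb{R}^d$ which, for every $i\in\{0,1,\ldots,k\}$, intersects the images under $\varphi_i$ of two disjoint faces of $\Delta_i$; that is, for every $i$ there are disjoint faces $\tau_{i1},\tau_{i2}$ of $\Delta_i$ with $F\cap\varphi_i(\tau_{i1})\neq\emptyset$ and $F\cap\varphi_i(\tau_{i2})\neq\emptyset$.
   Context: An affine $k$-flat in $\mathbb{R}^d$ is a $k$-dimensional affine subspace of $\mathbb{R}^d$ (a single point when $k=0$). A face of a simplex is the (closed) convex hull of a nonempty subset of its vertices; two faces are disjoint if they have no common point, equivalently if they have no common vertex. *)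

theory Defs
  imports "HOL-Analysis.Analysis"
begin

definition simplex_with_vertices :: "nat \<Rightarrow> (nat \<Rightarrow> 'b::euclidean_space) \<Rightarrow> 'b set \<Rightarrow> bool" where
  "simplex_with_vertices n e S \<longleftrightarrow>
     inj_on e {0..n} \<and> \<not> affine_dependent (e ` {0..n}) \<and> S = convex hull (e ` {0..n})"

lemma simplex_with_vertices_imp_simplex:
  assumes "simplex_with_vertices n e S"
  shows "int n simplex S"
  using assms unfolding simplex_with_vertices_def simplex_def
  by (intro exI[of _ "e ` {0..n}"]) (simp add: card_image)

text \<open>Unlike in the library notion \<^const>\<open>face_of\<close>, the empty set is not a face.\<close>

definition face_of_simplex :: "nat \<Rightarrow> (nat \<Rightarrow> 'b::euclidean_space) \<Rightarrow> 'b set \<Rightarrow> bool" where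
  "face_of_simplex n e \<tau> \<longleftrightarrow> (\<exists>J. J \<subseteq> {0..n} \<and> J \<noteq> {} \<and> \<tau> = convex hull (e ` J))"

lemma face_of_simplex_iff_face_of:
  assumes "simplex_with_vertices n e S"
  shows "face_of_simplex n e \<tau> \<longleftrightarrow> \<tau> face_of S \<and> \<tau> \<noteq> {}"
proof -
  have S: "S = convex hull (e ` {0..n})" and aff: "\<not> affine_dependent (e ` {0..n})"
    using assms by (simp_all add: simplex_with_vertices_def)
  have "\<tau> face_of S \<longleftrightarrow> (\<exists>C\<subseteq>e ` {0..n}. \<tau> = convex hull C)"
    unfolding S using aff by (rule face_of_convex_hull_affine_independent)
  also have "\<dots> \<longleftrightarrow> (\<exists>J\<subseteq>{0..n}. \<tau> = convex hull (e ` J))"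
    by (metis image_mono subset_imageE)
  finally have "\<tau> face_of S \<and> \<tau> \<noteq> {} \<longleftrightarrow>
      (\<exists>J\<subseteq>{0..n}. \<tau> = convex hull (e ` J)) \<and> \<tau> \<noteq> {}"
    by (rule arg_cong)
  also have "\<dots> \<longleftrightarrow> (\<exists>J. J \<subseteq> {0..n} \<and> J \<noteq> {} \<and> \<tau> = convex hull (e ` J))"
    by (metis convex_hull_eq_empty image_is_empty)
  finally show ?thesis
    unfolding face_of_simplex_def by (rule sym)
qed

definition affine_flat :: "nat \<Rightarrow> 'a::euclidean_space set \<Rightarrow> bool" where
  "affine_flat k F \<longleftrightarrow> affine F \<and> aff_dim F = int k"

end

theory Submission
  imports Defs "HOL-Library.Z2"
begin

text \<open>
  Put \<open>n = d - k\<close>. A \<open>k\<close>-flat is the solution set of \<open>n\<close> equations \<open>u\<^sub>a \<bullet> y = c\<^sub>a\<close> with pairwise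
  orthogonal non-zero \<open>u\<^sub>a\<close>, and \<open>u\<^sub>a\<close> may be taken in the span of the first \<open>k + a + 1\<close> basis vectors
  (\<open>a < n\<close>). Pairs of points in disjoint faces of an \<open>(n+1)\<close>-simplex are parametrised by an
  \<open>(n+1)\<close>-sphere, on which exchanging the two points is the antipodal map. The theorem thus asks for a
  common zero of real functions on a product of spheres, as many functions as the dimension, each odd
  in some of the factors and even in the others. Order the factors as \<open>u\<^sub>0, \<dots>, u\<^sub>n\<^sub>-\<^sub>1\<close> followed by the
  \<open>k + 1\<close> deleted joins; then each factor of dimension \<open>p\<close> is the last odd factor of exactly \<open>p\<close> of
  the functions, so the mod 2 cup product of the corresponding classes of the quotient by all
  antipodal maps is non-zero, and a common zero exists.

  The cup product is evaluated combinatorially: signs of the functions at the vertices of a fine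
  invariant triangulation are 0-cochains upstairs, whose coboundaries descend to the quotient. The
  number mod 2 of top simplices along which all signs alternate does not depend on the choice of
  equivariant signs, and is 1 for a standard choice. Alternating simplices in finer and finer
  triangulations accumulate at a common zero.
\<close>

section \<open>Alternating flags in a product of cube boundaries\<close>

declare add_bit_eq_xor [simp del] mult_bit_eq_and [simp del]

text \<open>A point \<open>v\<close> of the integer grid encodes a cell of a cubical complex: even coordinates are
  vertices and odd coordinates are open unit edges of a line subdivided into edges of length two.
  Thus \<open>verts\<close> is the face poset of a product of \<open>m\<close> boundaries of cubes, the cube with index \<open>a\<close>
  having dimension \<open>p a + 1\<close>, and \<open>chains\<close> are its maximal flags, the top simplices of the
  barycentric subdivision. This subdivision, unlike the usual ordered one of the grid, has a vertex
  order invariant under sign changes.\<close>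

locale grid =
  fixes m :: nat and p :: "nat \<Rightarrow> nat" and M :: int
  assumes M_even: "even M" and M_pos: "M > 0"
begin

declare split_paired_All [simp del] split_paired_Ex [simp del]

definition idx :: "(nat \<times> nat) set" where
  "idx = (SIGMA a:{..<m}. {..p a})"

definition N :: nat where "N = (\<Sum>a<m. p a)"

definition verts :: "(nat \<times> nat \<Rightarrow> int) set" where
  "verts = {v. (\<forall>i. i \<notin> idx \<longrightarrow> v i = 0) \<and> (\<forall>i. \<bar>v i\<bar> \<le> M) \<and> (\<forall>a<m. \<exists>r\<le>p a. \<bar>v (a, r)\<bar> = M)}"

text \<open>The covering relation of the face poset: a vertex coordinate is widened to one of its
  two adjacent edges, which raises the dimension by one.\<close>

definition step :: "(nat \<times> nat \<Rightarrow> int) \<Rightarrow> (nat \<times> nat \<Rightarrow> int) \<Rightarrow> bool" where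
  "step v w \<longleftrightarrow> (\<exists>i y. even (v i) \<and> \<bar>y - v i\<bar> = 1 \<and> w = v(i := y))"

definition chains :: "(nat \<Rightarrow> nat \<times> nat \<Rightarrow> int) set" where
  "chains = {\<sigma>. (\<forall>j\<le>N. \<sigma> j \<in> verts) \<and> (\<forall>i. even (\<sigma> 0 i)) \<and>
     (\<forall>j<N. step (\<sigma> j) (\<sigma> (Suc j))) \<and> (\<forall>j>N. \<sigma> j = (\<lambda>_. 0))}"

lemma finite_idx: "finite idx"
  by (simp add: idx_def)

lemma card_idx: "card idx = N + m"
  by (simp add: idx_def N_def sum_Suc)

lemma finite_verts: "finite verts"
proof -
  have "verts \<subseteq> {f. \<forall>x. (x \<in> idx \<longrightarrow> f x \<in> {-M..M}) \<and> (x \<notin> idx \<longrightarrow> f x = 0)}"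
    by (auto simp: verts_def abs_le_iff) (metis minus_le_iff)
  then show ?thesis
    using finite_set_of_finite_funs[OF finite_idx, of "{-M..M}" 0] finite_subset by blast
qed

lemma finite_chains: "finite chains"
proof -
  have "chains \<subseteq> {f. \<forall>x. (x \<in> {..N} \<longrightarrow> f x \<in> verts) \<and> (x \<notin> {..N} \<longrightarrow> f x = (\<lambda>_. 0))}"
    by (auto simp: chains_def)
  then show ?thesis
    using finite_set_of_finite_funs[of "{..N}" verts "\<lambda>_. 0"] finite_verts finite_subset by blast
qed

lemma verts_idx: "v \<in> verts \<Longrightarrow> v i \<noteq> 0 \<Longrightarrow> i \<in> idx"
  by (auto simp: verts_def)

lemma verts_abs_le: "v \<in> verts \<Longrightarrow> \<bar>v i\<bar> \<le> M"
  by (auto simp: verts_def)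

lemma verts_peak: "v \<in> verts \<Longrightarrow> a < m \<Longrightarrow> \<exists>r\<le>p a. \<bar>v (a, r)\<bar> = M"
  unfolding verts_def by blast

text \<open>The number of odd coordinates is the dimension of a cell, and every step makes exactly
  one more coordinate odd.\<close>

lemma card_odd_coords:
  assumes "\<sigma> \<in> chains" "j \<le> N"
  shows "card {i. odd (\<sigma> j i)} = j"
  using assms(2)
proof (induction j)
  case 0
  then show ?case using assms(1) by (simp add: chains_def)
next
  case (Suc j)
  have "step (\<sigma> j) (\<sigma> (Suc j))"
    using assms(1) Suc.prems by (simp add: chains_def)
  then obtain i y where i: "even (\<sigma> j i)" "\<bar>y - \<sigma> j i\<bar> = 1" "\<sigma> (Suc j) = (\<sigma> j)(i := y)"
    unfolding step_def by blast
  then have "odd y"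
    by presburger
  then have eq: "{i. odd (\<sigma> (Suc j) i)} = insert i {i. odd (\<sigma> j i)}"
    using i by auto
  have "\<sigma> j \<in> verts" using assms Suc.prems by (simp add: chains_def)
  then have "{i. odd (\<sigma> j i)} \<subseteq> idx"
    by (auto simp: verts_def)
  then have "finite {i. odd (\<sigma> j i)}"
    using finite_idx finite_subset by blast
  then show ?case
    using Suc i(1) by (simp add: eq)
qed

section \<open>Local structure of the face poset: one alternative for each member of a flag\<close>

text \<open>Since \<open>M\<close> is even, an odd coordinate is never a peak, so moving it to an
  even neighbour respects the bound and keeps all peaks.\<close>

lemma verts_down:
  assumes "w \<in> verts" "even y" "\<bar>y - w i\<bar> = 1"
  shows "w(i := y) \<in> verts"
proof -
  have o: "odd (w i)" using assms by presburger
  have "\<bar>w i\<bar> \<noteq> M" using o M_even by auto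
  then have "\<bar>w i\<bar> < M" using verts_abs_le[OF assms(1), of i] by linarith
  then have 1: "\<bar>y\<bar> \<le> M" using assms(3) by linarith
  have "w i \<noteq> 0" using o by auto
  then have 2: "i \<in> idx" using assms(1) verts_idx by blast
  have "\<exists>r\<le>p a. \<bar>(w(i := y)) (a, r)\<bar> = M" if am: "a < m" for a
  proof -
    obtain r where "r \<le> p a" "\<bar>w (a, r)\<bar> = M"
      using verts_peak[OF assms(1) am] by blast
    then show ?thesis using \<open>\<bar>w i\<bar> \<noteq> M\<close> by (intro exI[of _ r]) auto
  qed
  then show ?thesis
    using 1 2 assms(1) by (auto simp: verts_def)
qed

text \<open>An edge has two end points: its odd coordinate can be lowered to either even neighbour,
  \<open>v i\<close> or the mirror image \<open>2 * y - v i\<close>.\<close>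

lemma diamond_bot:
  assumes "w \<in> verts" "step v w" "\<And>i. even (v i)"
  obtains v' where "v' \<noteq> v"
    "\<And>u. u \<in> verts \<and> (\<forall>i. even (u i)) \<and> step u w \<longleftrightarrow> u = v \<or> u = v'"
proof -
  obtain i y where i: "\<bar>y - v i\<bar> = 1" "w = v(i := y)"
    using assms unfolding step_def by blast
  define v' where "v' = w(i := 2 * y - v i)"
  have y: "odd y" using i assms(3)[of i] by presburger
  have v: "v = w(i := v i)" using i by auto
  have ne: "v' \<noteq> v"
  proof
    assume "v' = v"
    then have "2 * y - v i = v i" by (metis v'_def fun_upd_same)
    then show False using i by auto
  qed
  have st: "step (w(i := z)) w" if "even z" "\<bar>z - y\<bar> = 1" for z
    unfolding step_def using that i by (intro exI[of _ i] exI[of _ y]) auto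
  have ev: "even ((w(i := z)) j)" if "even z" for j z
    using that assms(3) i by auto
  have "u \<in> verts \<and> (\<forall>i. even (u i)) \<and> step u w \<longleftrightarrow> u = v \<or> u = v'" for u
  proof
    assume u: "u \<in> verts \<and> (\<forall>i. even (u i)) \<and> step u w"
    then obtain j z where j: "\<bar>z - u j\<bar> = 1" "w = u(j := z)"
      unfolding step_def by blast
    have "even (u j)" using u by blast
    then have "odd z" using j by presburger
    then have "odd (w j)" using j by auto
    then have "j = i" using i assms(3) by (metis fun_upd_apply)
    moreover have "z = y" using j i \<open>j = i\<close> by (metis fun_upd_same)
    ultimately have "u = w(i := u i)" "\<bar>y - u i\<bar> = 1" using j by auto
    then have "u i = v i \<or> u i = 2 * y - v i" using i(1) by linarith
    then show "u = v \<or> u = v'"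
      using v \<open>u = w(i := u i)\<close> unfolding v'_def by metis
  next
    assume "u = v \<or> u = v'"
    then obtain z where z: "u = w(i := z)" "even z" "\<bar>z - y\<bar> = 1"
    proof
      assume "u = v" then show ?thesis using that[of "v i"] v assms(3)[of i] i by force
    next
      assume "u = v'" then show ?thesis using that[of "2 * y - v i"] v'_def assms(3)[of i] i by force
    qed
    have "w i = y" using i by simp
    then show "u \<in> verts \<and> (\<forall>i. even (u i)) \<and> step u w"
      using z st[of z] ev[of z] verts_down[OF assms(1), of z i] by simp
  qed
  then show ?thesis using that ne by blast
qed

text \<open>Two coordinates become odd on the way from \<open>v\<close> to \<open>w\<close>; the two
  middle cells correspond to the two orders of doing this.\<close>

lemma diamond_mid:
  assumes "w \<in> verts" "step v u" "step u w"
  obtains u' where "u' \<noteq> u"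
    "\<And>x. x \<in> verts \<and> step v x \<and> step x w \<longleftrightarrow> x = u \<or> x = u'"
proof -
  obtain i y where i: "even (v i)" "\<bar>y - v i\<bar> = 1" "u = v(i := y)"
    using assms unfolding step_def by blast
  obtain j z where j: "even (u j)" "\<bar>z - u j\<bar> = 1" "w = u(j := z)"
    using assms unfolding step_def by blast
  have "odd y" using i by presburger
  then have ij: "i \<noteq> j" using i j by auto
  then have vj: "even (v j)" "\<bar>z - v j\<bar> = 1" using i j by auto
  have "odd z" using vj by presburger
  have w: "w = v(i := y, j := z)" using i j by simp
  have yv: "y \<noteq> v i" "z \<noteq> v j" using i vj by auto
  define u' where "u' = v(j := z)"
  have ne: "u' \<noteq> u" using yv ij unfolding u'_def i(3) by (metis fun_upd_apply)
  have "x \<in> verts \<and> step v x \<and> step x w \<longleftrightarrow> x = u \<or> x = u'" for x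
  proof
    assume x: "x \<in> verts \<and> step v x \<and> step x w"
    obtain k t where k: "even (v k)" "\<bar>t - v k\<bar> = 1" "x = v(k := t)"
      using x unfolding step_def by blast
    obtain l s where l: "even (x l)" "\<bar>s - x l\<bar> = 1" "w = x(l := s)"
      using x unfolding step_def by blast
    have "odd t" using k by presburger
    then have "k \<noteq> l" using k l by auto
    then have wk: "w k = t" using k l by simp
    then have "k = i \<or> k = j" using w k(2) by (auto simp: fun_upd_def split: if_splits)
    then show "x = u \<or> x = u'"
      using k(3) wk w ij i(3) u'_def by auto
  next
    have "u \<in> verts"
    proof -
      have "u = w(j := u j)" using j by auto
      then show ?thesis using verts_down[OF assms(1), of "u j" j] j by (simp add: abs_minus_commute)
    qed
    moreover have "u' \<in> verts"
    proof -
      have "u' = w(i := v i)" using w ij u'_def by auto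
      then show ?thesis using verts_down[OF assms(1), of "v i" i] i w ij by (simp add: abs_minus_commute)
    qed
    moreover have "step v u'" using vj u'_def unfolding step_def by blast
    moreover have "step u' w"
      unfolding step_def using i ij w u'_def
      by (intro exI[of _ i] exI[of _ y]) (auto simp: fun_upd_twist)
    moreover assume "x = u \<or> x = u'"
    ultimately show "x \<in> verts \<and> step v x \<and> step x w" using assms by blast
  qed
  then show ?thesis using that ne by blast
qed

text \<open>By a dimension count one even coordinate is left besides one peak per block. The second
  cell arises by moving it the other way or, at a corner where it is a peak too, by moving the other
  peak inward.\<close>

lemma diamond_top:
  assumes v: "v \<in> verts" and c: "Suc (card {i. odd (v i)}) = N" and w: "w \<in> verts" "step v w"
  obtains w' where "w' \<noteq> w" "\<And>x. x \<in> verts \<and> step v x \<longleftrightarrow> x = w \<or> x = w'"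
proof -
  define E where "E a = {r. r \<le> p a \<and> even (v (a, r))}" for a
  have finE: "finite (E a)" for a unfolding E_def by simp
  have peak: "\<exists>r. r \<in> E a \<and> \<bar>v (a, r)\<bar> = M" if am: "a < m" for a
  proof -
    obtain r where r: "r \<le> p a" "\<bar>v (a, r)\<bar> = M"
      using verts_peak[OF v am] by blast
    moreover have "even (v (a, r))" using r M_even by (metis dvd_abs_iff)
    ultimately show ?thesis unfolding E_def by blast
  qed
  have E1: "1 \<le> card (E a)" if "a < m" for a
    using peak[OF that] finE[of a] card_gt_0_iff[of "E a"] by fastforce
  have odd_sub: "{i. odd (v i)} \<subseteq> idx"
    using v by (auto simp: verts_def)
  have "idx - {i. odd (v i)} = (SIGMA a:{..<m}. E a)"
    by (auto simp: idx_def E_def)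
  then have "card (SIGMA a:{..<m}. E a) = card idx - card {i. odd (v i)}"
    using odd_sub finite_idx by (metis card_Diff_subset finite_subset)
  then have "(\<Sum>a<m. card (E a)) = Suc m"
    using card_idx c finE by simp
  moreover have "(\<Sum>a<m. card (E a) - 1) = (\<Sum>a<m. card (E a)) - (\<Sum>a<m. 1)"
    using E1 by (intro sum_subtractf_nat) auto
  \<comment> \<open>Of the \<open>N + m\<close> coordinates \<open>N - 1\<close> are odd, so
    \<open>m + 1\<close> are even. Each block has an even peak, hence exactly one block has a second
    even coordinate.\<close>
  ultimately have sumE: "(\<Sum>a<m. card (E a) - 1) = 1"
    by simp
  obtain i y where i: "even (v i)" "\<bar>y - v i\<bar> = 1" "w = v(i := y)"
    using w unfolding step_def by blast
  have "odd y" using i by presburger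
  then have "i \<in> idx" using verts_idx[OF w(1), of i] i by auto
  then obtain a r where ar: "i = (a, r)" "a < m" "r \<le> p a" by (auto simp: idx_def)
  have rE: "r \<in> E a" using ar i by (simp add: E_def)
  obtain q where q: "q \<le> p a" "\<bar>w (a, q)\<bar> = M"
    using verts_peak[OF w(1) ar(2)] by blast
  have qr: "q \<noteq> r" using q \<open>odd y\<close> i ar M_even by auto
  then have vq: "\<bar>v (a, q)\<bar> = M" using q i ar by auto
  then have qE: "q \<in> E a" using q M_even E_def by (metis (mono_tags, lifting) dvd_abs_iff mem_Collect_eq)
  have "card {q, r} \<le> card (E a)" using qE rE finE by (intro card_mono) auto
  then have "2 \<le> card (E a)" using qr by simp
  have "card (E a) - 1 + (\<Sum>b\<in>{..<m} - {a}. card (E b) - 1) = 1"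
    using sumE ar(2) by (simp add: sum.remove)
  then have ca: "card (E a) = 2" and "(\<Sum>b\<in>{..<m} - {a}. card (E b) - 1) = 0"
    using \<open>2 \<le> card (E a)\<close> by linarith+
  then have cb: "card (E b) = 1" if "b < m" "b \<noteq> a" for b
    using that E1[of b] by (simp add: le_antisym)
  have Ea: "E a = {q, r}"
    using card_subset_eq[of "E a" "{q, r}"] finE qE rE ca qr by auto
  \<comment> \<open>Either even coordinate of block \<open>a\<close> may move, provided that the
    other one is a peak; \<open>q\<close> is always one.\<close>
  have char: "x \<in> verts \<and> step v x \<longleftrightarrow>
      (\<exists>z. \<bar>z\<bar> \<le> M \<and> ((x = v((a, r) := z) \<and> \<bar>z - v (a, r)\<bar> = 1) \<or>
           (x = v((a, q) := z) \<and> \<bar>z - v (a, q)\<bar> = 1 \<and> \<bar>v (a, r)\<bar> = M)))" for x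
  proof
    assume x: "x \<in> verts \<and> step v x"
    then obtain j z where j: "even (v j)" "\<bar>z - v j\<bar> = 1" "x = v(j := z)"
      unfolding step_def by blast
    have "odd z" using j by presburger
    then have "j \<in> idx" using x verts_idx[of x j] j by auto
    then obtain b s where bs: "j = (b, s)" "b < m" "s \<le> p b" by (auto simp: idx_def)
    have sE: "s \<in> E b" using bs j by (simp add: E_def)
    obtain t where t: "t \<le> p b" "\<bar>x (b, t)\<bar> = M"
      using verts_peak[of x b] x bs(2) by blast
    have ts: "t \<noteq> s" using t \<open>odd z\<close> j bs M_even by auto
    then have vt: "\<bar>v (b, t)\<bar> = M" using t j bs by auto
    then have tE: "t \<in> E b" using t M_even E_def by (metis (mono_tags, lifting) dvd_abs_iff mem_Collect_eq)
    have "b = a"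
      using cb[OF bs(2)] sE tE ts by (metis card_1_singletonE singletonD)
    moreover have "\<bar>z\<bar> \<le> M" using x j verts_abs_le[of x j] by simp
    moreover have "s = q \<longrightarrow> t = r" "s = r \<or> s = q" using sE tE ts \<open>b = a\<close> Ea by auto
    ultimately show "\<exists>z. \<bar>z\<bar> \<le> M \<and> ((x = v((a, r) := z) \<and> \<bar>z - v (a, r)\<bar> = 1) \<or>
           (x = v((a, q) := z) \<and> \<bar>z - v (a, q)\<bar> = 1 \<and> \<bar>v (a, r)\<bar> = M))"
      using j bs vt by blast
  next
    have A: "v((a, s) := z) \<in> verts \<and> step v (v((a, s) := z))"
      if s: "s \<in> {q, r}" "t \<in> {q, r}" "t \<noteq> s" "\<bar>v (a, t)\<bar> = M"
      and z: "\<bar>z\<bar> \<le> M" "\<bar>z - v (a, s)\<bar> = 1" for s t z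
    proof
      have "s \<in> E a" "t \<in> E a" using s Ea by auto
      show "step v (v((a, s) := z))"
        using \<open>s \<in> E a\<close> z unfolding step_def E_def by blast
      have "(a, s) \<in> idx" using \<open>s \<in> E a\<close> ar by (auto simp: idx_def E_def)
      moreover have "\<exists>r\<le>p b. \<bar>(v((a, s) := z)) (b, r)\<bar> = M" if "b < m" for b
      proof (cases "b = a")
        case True
        then show ?thesis using s \<open>t \<in> E a\<close> by (intro exI[of _ t]) (auto simp: E_def)
      next
        case False
        then show ?thesis using verts_peak[OF v that] by auto
      qed
      ultimately show "v((a, s) := z) \<in> verts"
        using v z by (auto simp: verts_def)
    qed
    assume "\<exists>z. \<bar>z\<bar> \<le> M \<and> ((x = v((a, r) := z) \<and> \<bar>z - v (a, r)\<bar> = 1) \<or>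
           (x = v((a, q) := z) \<and> \<bar>z - v (a, q)\<bar> = 1 \<and> \<bar>v (a, r)\<bar> = M))"
    then show "x \<in> verts \<and> step v x" using A[of r q] A[of q r] vq qr by auto
  qed
  have vr: "\<bar>v (a, r)\<bar> \<le> M" using v verts_abs_le by blast
  have yM: "\<bar>y\<bar> \<le> M" using verts_abs_le[OF w(1), of i] i by simp
  have wy: "w = v((a, r) := y)" "\<bar>y - v (a, r)\<bar> = 1" using i ar by auto
  show ?thesis
  proof (cases "\<bar>v (a, r)\<bar> = M")
    case True
    define z where "z = v (a, q) - sgn (v (a, q))"
    have zu: "\<bar>t\<bar> \<le> M \<and> \<bar>t - v (a, q)\<bar> = 1 \<longleftrightarrow> t = z" for t
      using vq M_pos unfolding z_def sgn_if by auto
    have yu: "\<bar>t\<bar> \<le> M \<and> \<bar>t - v (a, r)\<bar> = 1 \<longleftrightarrow> t = y" for t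
      using True wy yM M_pos by auto
    have "z \<noteq> v (a, q)" using zu[of z] by auto
    then have "v((a, q) := z) \<noteq> w" unfolding wy using qr by (metis fun_upd_apply prod.inject)
    moreover have "x \<in> verts \<and> step v x \<longleftrightarrow> x = w \<or> x = v((a, q) := z)" for x
      unfolding char wy(1) using True zu yu by metis
    ultimately show ?thesis using that by blast
  next
    case False
    have "even (v (a, r))" using rE by (simp add: E_def)
    have yu: "\<bar>t\<bar> \<le> M \<and> \<bar>t - v (a, r)\<bar> = 1 \<longleftrightarrow> t = y \<or> t = 2 * v (a, r) - y" for t
      using False vr wy yM M_pos by auto
    have "2 * v (a, r) - y \<noteq> y" using wy by auto
    then have "v((a, r) := 2 * v (a, r) - y) \<noteq> w" unfolding wy by (metis fun_upd_same)
    moreover have "x \<in> verts \<and> step v x \<longleftrightarrow> x = w \<or> x = v((a, r) := 2 * v (a, r) - y)" for x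
      unfolding char wy(1) using False yu by metis
    ultimately show ?thesis using that by blast
  qed
qed

text \<open>The subdivision is a pseudomanifold: each codimension one face lies in exactly two top simplices.\<close>

lemma chain_diamond:
  assumes \<sigma>: "\<sigma> \<in> chains" and "j \<le> N" "0 < N"
  obtains w' where "w' \<noteq> \<sigma> j" "\<And>w. \<sigma>(j := w) \<in> chains \<longleftrightarrow> w = \<sigma> j \<or> w = w'"
proof -
  have V: "\<sigma> i \<in> verts" if "i \<le> N" for i using \<sigma> that by (simp add: chains_def)
  have S: "step (\<sigma> i) (\<sigma> (Suc i))" if "i < N" for i using \<sigma> that by (simp add: chains_def)
  have E: "even (\<sigma> 0 i)" for i using \<sigma> by (simp add: chains_def)
  have Z: "\<sigma> i = (\<lambda>_. 0)" if "i > N" for i using \<sigma> that by (simp add: chains_def)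
  consider "j = 0" | "0 < j" "j < N" | "j = N" using assms by linarith
  then show ?thesis
  proof cases
    case 1
    have eq: "\<sigma>(j := w) \<in> chains \<longleftrightarrow> w \<in> verts \<and> (\<forall>i. even (w i)) \<and> step w (\<sigma> 1)" for w
      unfolding chains_def 1 using V S E Z \<open>0 < N\<close> by auto
    show ?thesis
      using diamond_bot[of "\<sigma> 1" "\<sigma> 0"] V[of 1] S[of 0] E \<open>0 < N\<close> that eq 1 by auto
  next
    case 2
    then obtain l where l: "j = Suc l" by (cases j) auto
    have eq: "\<sigma>(j := w) \<in> chains \<longleftrightarrow> w \<in> verts \<and> step (\<sigma> l) w \<and> step w (\<sigma> (Suc j))" for w
      unfolding chains_def using V S E Z 2 l by auto
    show ?thesis
      using diamond_mid[of "\<sigma> (Suc j)" "\<sigma> l" "\<sigma> j"] V[of "Suc j"] S[of l] S[of j] 2 l that eq by auto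
  next
    case 3
    then obtain l where l: "j = Suc l" using assms not0_implies_Suc by blast
    have "N = Suc l" using 3 l by simp
    have eq: "\<sigma>(j := w) \<in> chains \<longleftrightarrow> w \<in> verts \<and> step (\<sigma> l) w" for w
      unfolding chains_def using V S E Z \<open>j = Suc l\<close> \<open>N = Suc l\<close> by auto
    have "Suc (card {i. odd (\<sigma> l i)}) = N" using card_odd_coords[OF \<sigma>, of l] 3 l by simp
    then show ?thesis
      using diamond_top[of "\<sigma> l" "\<sigma> j"] V[of l] V[of j] S[of l] 3 l that eq by auto
  qed
qed

section \<open>Sign changes and invariant sums over chains\<close>

definition flip :: "nat set \<Rightarrow> (nat \<times> nat \<Rightarrow> int) \<Rightarrow> nat \<times> nat \<Rightarrow> int" where
  "flip S v = (\<lambda>i. if fst i \<in> S then - v i else v i)"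

text \<open>With \<open>sign_bit\<close> this is the standard cell structure of a sphere, two open
  hemispheres in each dimension: \<open>top_coord\<close> is the dimension and
  \<open>sign_bit\<close> names the hemisphere.\<close>

definition top_coord :: "nat \<Rightarrow> (nat \<times> nat \<Rightarrow> int) \<Rightarrow> nat" where
  "top_coord a v = Max {r. r \<le> p a \<and> v (a, r) \<noteq> 0}"

definition sign_bit :: "nat \<Rightarrow> (nat \<times> nat \<Rightarrow> int) \<Rightarrow> bit" where
  "sign_bit a v = of_bool (v (a, top_coord a v) < 0)"

lemma flip_flip: "flip S (flip S v) = v"
  by (auto simp: flip_def)

lemma flip_verts: "v \<in> verts \<Longrightarrow> flip S v \<in> verts"
  by (auto simp: flip_def verts_def)

lemma step_flip: "step v w \<Longrightarrow> step (flip S v) (flip S w)"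
proof -
  assume "step v w"
  then obtain i y where i: "even (v i)" "\<bar>y - v i\<bar> = 1" "w = v(i := y)"
    unfolding step_def by blast
  show ?thesis
    unfolding step_def using i
    by (intro exI[of _ i] exI[of _ "flip S w i"]) (auto simp: flip_def fun_eq_iff)
qed

lemma flip_chains: "\<sigma> \<in> chains \<Longrightarrow> (\<lambda>j. flip S (\<sigma> j)) \<in> chains"
  unfolding chains_def by (auto simp: flip_verts step_flip) (auto simp: flip_def)

lemma top_coord:
  assumes "v \<in> verts" "a < m"
  shows "top_coord a v \<le> p a" "v (a, top_coord a v) \<noteq> 0"
    and "\<And>r. r \<le> p a \<Longrightarrow> v (a, r) \<noteq> 0 \<Longrightarrow> r \<le> top_coord a v"
proof -
  let ?S = "{r. r \<le> p a \<and> v (a, r) \<noteq> 0}"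
  obtain r where "r \<le> p a" "\<bar>v (a, r)\<bar> = M" using verts_peak[OF assms] by blast
  then have "?S \<noteq> {}" using M_pos by auto
  then have "top_coord a v \<in> ?S"
    unfolding top_coord_def by (intro Max_in) auto
  then show "top_coord a v \<le> p a" "v (a, top_coord a v) \<noteq> 0" by auto
  show "r \<le> p a \<Longrightarrow> v (a, r) \<noteq> 0 \<Longrightarrow> r \<le> top_coord a v" for r
    unfolding top_coord_def by (intro Max_ge) auto
qed

lemma sign_bit_flip:
  assumes "v \<in> verts" "a < m"
  shows "sign_bit a (flip S v) = sign_bit a v + of_bool (a \<in> S)"
proof -
  have "top_coord a (flip S v) = top_coord a v"
    by (simp add: top_coord_def flip_def)
  then show ?thesis
    using top_coord(2)[OF assms] by (auto simp: sign_bit_def flip_def)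
qed

text \<open>The constraint on \<open>\<sigma> l\<close> selects one chain from each orbit of the sign changes, so this is
  the evaluation of an invariant top cochain on the mod 2 fundamental cycle of the quotient.\<close>

definition chain_sum :: "nat \<Rightarrow> ((nat \<Rightarrow> nat \<times> nat \<Rightarrow> int) \<Rightarrow> bit) \<Rightarrow> bit" where
  "chain_sum l W = sum W {\<sigma> \<in> chains. \<forall>a<m. sign_bit a (\<sigma> l) = 0}"

definition flip_inv :: "((nat \<Rightarrow> nat \<times> nat \<Rightarrow> int) \<Rightarrow> bit) \<Rightarrow> bool" where
  "flip_inv W \<longleftrightarrow> (\<forall>\<sigma>\<in>chains. \<forall>S. W (\<lambda>j. flip S (\<sigma> j)) = W \<sigma>)"

definition indep_of :: "nat \<Rightarrow> ((nat \<Rightarrow> nat \<times> nat \<Rightarrow> int) \<Rightarrow> bit) \<Rightarrow> bool" where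
  "indep_of j W \<longleftrightarrow> (\<forall>\<sigma> w. W (\<sigma>(j := w)) = W \<sigma>)"

lemma chain_sum_add: "chain_sum l (\<lambda>\<sigma>. V \<sigma> + W \<sigma>) = chain_sum l V + chain_sum l W"
  by (simp add: chain_sum_def sum.distrib)

lemma chain_sum_cong: "(\<And>\<sigma>. \<sigma> \<in> chains \<Longrightarrow> V \<sigma> = W \<sigma>) \<Longrightarrow> chain_sum l V = chain_sum l W"
  unfolding chain_sum_def by (rule sum.cong) auto

text \<open>\<open>h k\<close> moves a chain within its orbit to the representative whose vertex
  \<open>k\<close> has all sign bits zero; \<open>h l\<close> and \<open>h l'\<close> are mutually
  inverse between the two sets of representatives.\<close>

lemma chain_sum_switch:
  assumes W: "flip_inv W" and "l \<le> N" "l' \<le> N"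
  shows "chain_sum l W = chain_sum l' W"
proof -
  define h where "h k \<sigma> = (\<lambda>j. flip {a. a < m \<and> sign_bit a (\<sigma> k) = 1} (\<sigma> j))"
    for k and \<sigma> :: "nat \<Rightarrow> nat \<times> nat \<Rightarrow> int"
  have V: "\<sigma> i \<in> verts" if "\<sigma> \<in> chains" "i \<le> N" for \<sigma> i using that by (simp add: chains_def)
  have hh: "h k (h k' \<sigma>) = \<sigma>" if "\<sigma> \<in> chains" "\<forall>a<m. sign_bit a (\<sigma> k) = 0" "k \<le> N" "k' \<le> N" for k k' \<sigma>
  proof -
    let ?S = "{a. a < m \<and> sign_bit a (\<sigma> k') = 1}"
    have "{a. a < m \<and> sign_bit a (flip ?S (\<sigma> k)) = 1} = ?S"
      using that V[of \<sigma> k] by (auto simp: sign_bit_flip)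
    then show ?thesis
      unfolding h_def by (simp only:) (simp only: flip_flip)
  qed
  have hP: "h k \<sigma> \<in> {\<sigma> \<in> chains. \<forall>a<m. sign_bit a (\<sigma> k) = 0}" if "\<sigma> \<in> chains" "k \<le> N" for k \<sigma>
    using that V[of \<sigma> k] by (auto simp: h_def flip_chains sign_bit_flip)
  have hW: "W (h k \<sigma>) = W \<sigma>" if "\<sigma> \<in> chains" for k \<sigma>
    using W that unfolding flip_inv_def h_def by blast
  show ?thesis
    unfolding chain_sum_def
    by (rule sum.reindex_bij_witness[where i = "h l" and j = "h l'"])
      (use assms hh hP hW in auto)
qed

text \<open>By \<open>chain_diamond\<close> the chains come in pairs differing only in vertex
  \<open>j\<close>, and equal values cancel mod 2.\<close>

lemma chain_sum_zero:
  assumes "flip_inv W" "indep_of j W" "j \<le> N" "0 < N" "l \<le> N"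
  shows "chain_sum l W = 0"
proof -
  \<comment> \<open>Representatives are selected at a vertex other than \<open>j\<close>, so that
    exchanging vertex \<open>j\<close> respects the selection.\<close>
  define l' :: nat where "l' = (if j = 0 then 1 else 0)"
  have l': "l' \<noteq> j" "l' \<le> N" using assms by (auto simp: l'_def)
  define P where "P = {\<sigma> \<in> chains. \<forall>a<m. sign_bit a (\<sigma> l') = 0}"
  \<comment> \<open>\<open>g\<close> forgets vertex \<open>j\<close>; its fibres in \<open>P\<close>
    are the cancelling pairs.\<close>
  define g where "g \<sigma> = \<sigma>(j := \<lambda>_. 0)" for \<sigma> :: "nat \<Rightarrow> nat \<times> nat \<Rightarrow> int"
  have "finite P" unfolding P_def using finite_chains by simp
  have "(\<Sum>x\<in>{x \<in> P. g x = y}. W x) = 0" if y: "y \<in> g ` P" for y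
  proof -
    obtain \<sigma> where \<sigma>: "\<sigma> \<in> P" "y = g \<sigma>" using y by blast
    then have "\<sigma> \<in> chains" by (simp add: P_def)
    then obtain w' where w': "w' \<noteq> \<sigma> j" "\<And>w. \<sigma>(j := w) \<in> chains \<longleftrightarrow> w = \<sigma> j \<or> w = w'"
      using chain_diamond[OF _ \<open>j \<le> N\<close> \<open>0 < N\<close>] by blast
    have "x \<in> P \<and> g x = y \<longleftrightarrow> x = \<sigma> \<or> x = \<sigma>(j := w')" for x
    proof
      assume x: "x \<in> P \<and> g x = y"
      then have "x = \<sigma>(j := x j)" unfolding \<sigma>(2) g_def by (metis fun_upd_triv fun_upd_upd)
      moreover from this have "x j = \<sigma> j \<or> x j = w'" using x w'(2)[of "x j"] by (simp add: P_def)
      ultimately show "x = \<sigma> \<or> x = \<sigma>(j := w')" by (metis fun_upd_triv)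
    next
      assume "x = \<sigma> \<or> x = \<sigma>(j := w')"
      then show "x \<in> P \<and> g x = y"
        using \<sigma> w'(2)[of w'] l' by (auto simp: P_def g_def)
    qed
    then have eq: "{x \<in> P. g x = y} = {\<sigma>, \<sigma>(j := w')}" by auto
    have "\<sigma> \<noteq> \<sigma>(j := w')" using w'(1) by (metis fun_upd_same)
    then show ?thesis
      unfolding eq using assms(2) by (simp add: indep_of_def)
  qed
  then have "sum W P = 0"
    using sum.image_gen[OF \<open>finite P\<close>, of W g] by simp
  then show ?thesis
    using chain_sum_switch[OF assms(1) \<open>l \<le> N\<close> l'(2)] by (simp add: chain_sum_def P_def)
qed

section \<open>Labels, their cocycles and cup products\<close>

text \<open>An equivariant 0-cochain. The differences \<open>s v + s w\<close> are invariant, hence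
  a 1-cocycle on the quotient, whose class is governed by \<open>t\<close>.\<close>

definition label :: "(nat set \<Rightarrow> bit) \<Rightarrow> ((nat \<times> nat \<Rightarrow> int) \<Rightarrow> bit) \<Rightarrow> bool" where
  "label t s \<longleftrightarrow> (\<forall>v\<in>verts. \<forall>S. s (flip S v) = s v + t S)"

lemma bit_add_self [simp]: "x + x = (0 :: bit)"
  by (cases x) auto

lemma label_diff:
  assumes "label t s" "v \<in> verts" "w \<in> verts"
  shows "s (flip S v) + s (flip S w) = s v + s w"
  using assms by (cases "t S") (auto simp: label_def)

lemma flip_inv_mult: "flip_inv V \<Longrightarrow> flip_inv W \<Longrightarrow> flip_inv (\<lambda>\<sigma>. V \<sigma> * W \<sigma>)"
  by (simp add: flip_inv_def)

lemma flip_inv_edge: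
  assumes "label t s" "i \<le> N" "j \<le> N"
  shows "flip_inv (\<lambda>\<sigma>. s (\<sigma> i) + s (\<sigma> j))"
  unfolding flip_inv_def
proof (intro ballI allI)
  fix \<sigma> S assume "\<sigma> \<in> chains"
  then have "\<sigma> i \<in> verts" "\<sigma> j \<in> verts" using assms by (simp_all add: chains_def)
  then show "s (flip S (\<sigma> i)) + s (flip S (\<sigma> j)) = s (\<sigma> i) + s (\<sigma> j)"
    by (rule label_diff[OF assms(1)])
qed

lemma flip_inv_prod:
  assumes "\<And>i. i \<in> A \<Longrightarrow> flip_inv (f i)"
  shows "flip_inv (\<lambda>\<sigma>. \<Prod>i\<in>A. f i \<sigma>)"
  using assms by (auto simp: flip_inv_def intro!: prod.cong)

text \<open>A coboundary argument without coboundaries: the cocycle identity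
  \<open>c(u,v) + c(v,w) = c(u,w)\<close> for \<open>c(v,w) = s v + s w\<close> moves the vertex on which the cochain does not
  depend one position at a time.\<close>

lemma chain_sum_low:
  assumes "\<And>i. label (t i) (s i)" "flip_inv R" "\<And>j. j \<le> e \<Longrightarrow> indep_of j R" "e < N"
  shows "chain_sum 0 (\<lambda>\<sigma>. (\<Prod>i<e. s i (\<sigma> i) + s i (\<sigma> (Suc i))) * R \<sigma>) = 0"
  using assms(2-)
proof (induction e arbitrary: R)
  case 0
  then show ?case using chain_sum_zero[of R 0 0] by simp
next
  case (Suc e)
  let ?P = "\<lambda>\<sigma>. \<Prod>i<e. s i (\<sigma> i) + s i (\<sigma> (Suc i))"
  let ?A = "\<lambda>\<sigma>. s e (\<sigma> e) + s e (\<sigma> (Suc (Suc e)))"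
  let ?B = "\<lambda>\<sigma>. s e (\<sigma> (Suc e)) + s e (\<sigma> (Suc (Suc e)))"
  \<comment> \<open>The edge from \<open>e\<close> to \<open>Suc e\<close> is routed via
    \<open>Suc (Suc e)\<close>. The \<open>?A\<close> term ignores vertex \<open>Suc e\<close>; in
    the \<open>?B\<close> term the tail \<open>?B * R\<close> ignores all vertices up to
    \<open>e\<close>, as the induction hypothesis demands.\<close>
  have split: "s e (\<sigma> e) + s e (\<sigma> (Suc e)) = ?A \<sigma> + ?B \<sigma>" for \<sigma>
    by (cases "s e (\<sigma> (Suc (Suc e)))") auto
  have P: "flip_inv ?P"
    using Suc.prems by (intro flip_inv_prod flip_inv_edge[OF assms(1)]) auto
  have "flip_inv (\<lambda>\<sigma>. ?P \<sigma> * ?A \<sigma> * R \<sigma>)"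
    using Suc.prems by (intro flip_inv_mult P flip_inv_edge[OF assms(1)]) auto
  moreover have "indep_of (Suc e) (\<lambda>\<sigma>. ?P \<sigma> * ?A \<sigma> * R \<sigma>)"
    using Suc.prems(2)[of "Suc e"] by (simp add: indep_of_def)
  ultimately have 1: "chain_sum 0 (\<lambda>\<sigma>. ?P \<sigma> * ?A \<sigma> * R \<sigma>) = 0"
    using Suc.prems by (intro chain_sum_zero[where j = "Suc e"]) auto
  have "flip_inv (\<lambda>\<sigma>. ?B \<sigma> * R \<sigma>)"
    using Suc.prems by (intro flip_inv_mult flip_inv_edge[OF assms(1)]) auto
  moreover have "indep_of j (\<lambda>\<sigma>. ?B \<sigma> * R \<sigma>)" if "j \<le> e" for j
    using Suc.prems(2)[of j] that by (simp add: indep_of_def)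
  ultimately have 2: "chain_sum 0 (\<lambda>\<sigma>. ?P \<sigma> * (?B \<sigma> * R \<sigma>)) = 0"
    using Suc.prems by (intro Suc.IH) auto
  have "chain_sum 0 (\<lambda>\<sigma>. (\<Prod>i<Suc e. s i (\<sigma> i) + s i (\<sigma> (Suc i))) * R \<sigma>) =
      chain_sum 0 (\<lambda>\<sigma>. ?P \<sigma> * ?A \<sigma> * R \<sigma> + ?P \<sigma> * (?B \<sigma> * R \<sigma>))"
    unfolding prod.lessThan_Suc split by (simp only: algebra_simps)
  then show ?case using 1 2 by (simp only: chain_sum_add add_0)
qed

text \<open>Mirror image of \<open>chain_sum_low\<close>: detours run through the preceding vertex,
  which exists because \<open>0 < e\<close>, and the induction descends from
  \<open>N\<close>.\<close>

lemma chain_sum_high: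
  assumes s: "\<And>i. label (t i) (s i)" and "flip_inv L" "\<And>j. j \<ge> e \<Longrightarrow> indep_of j L" "0 < e" "e \<le> N"
  shows "chain_sum 0 (\<lambda>\<sigma>. L \<sigma> * (\<Prod>i\<in>{e..<N}. s i (\<sigma> i) + s i (\<sigma> (Suc i)))) = 0"
  using assms(5) assms(2-4)
proof (induction e arbitrary: L rule: inc_induct)
  case base
  then show ?case using chain_sum_zero[of L N 0] by simp
next
  case (step e)
  then obtain l where l: "e = Suc l" by (cases e) auto
  let ?P = "\<lambda>\<sigma>. \<Prod>i\<in>{Suc e..<N}. s i (\<sigma> i) + s i (\<sigma> (Suc i))"
  let ?A = "\<lambda>\<sigma>. s e (\<sigma> l) + s e (\<sigma> (Suc e))"
  let ?B = "\<lambda>\<sigma>. s e (\<sigma> l) + s e (\<sigma> e)"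
  have split: "s e (\<sigma> e) + s e (\<sigma> (Suc e)) = ?A \<sigma> + ?B \<sigma>" for \<sigma>
    by (cases "s e (\<sigma> l)") auto
  have P: "flip_inv ?P"
    using step by (intro flip_inv_prod flip_inv_edge[OF s]) auto
  have "flip_inv (\<lambda>\<sigma>. L \<sigma> * ?A \<sigma> * ?P \<sigma>)"
    using step l by (intro flip_inv_mult P flip_inv_edge[OF s]) auto
  moreover have "indep_of e (\<lambda>\<sigma>. L \<sigma> * ?A \<sigma> * ?P \<sigma>)"
    using step.prems(2)[of e] l by (simp add: indep_of_def)
  ultimately have 1: "chain_sum 0 (\<lambda>\<sigma>. L \<sigma> * ?A \<sigma> * ?P \<sigma>) = 0"
    using step by (intro chain_sum_zero[where j = e]) auto
  have "flip_inv (\<lambda>\<sigma>. L \<sigma> * ?B \<sigma>)"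
    using step l by (intro flip_inv_mult flip_inv_edge[OF s]) auto
  moreover have "indep_of j (\<lambda>\<sigma>. L \<sigma> * ?B \<sigma>)" if "j \<ge> Suc e" for j
    using step.prems(2)[of j] that l by (simp add: indep_of_def)
  ultimately have 2: "chain_sum 0 (\<lambda>\<sigma>. L \<sigma> * ?B \<sigma> * ?P \<sigma>) = 0"
    by (intro step.IH) auto
  have "chain_sum 0 (\<lambda>\<sigma>. L \<sigma> * (\<Prod>i\<in>{e..<N}. s i (\<sigma> i) + s i (\<sigma> (Suc i)))) =
      chain_sum 0 (\<lambda>\<sigma>. L \<sigma> * ?A \<sigma> * ?P \<sigma> + L \<sigma> * ?B \<sigma> * ?P \<sigma>)"
    unfolding prod.atLeast_Suc_lessThan[OF step.hyps(2)] split by (simp only: algebra_simps)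
  then show ?case using 1 2 by (simp only: chain_sum_add add_0)
qed

text \<open>The cup product of the 1-cocycles given by the labels, evaluated on the fundamental cycle.\<close>

definition alternations :: "(nat \<Rightarrow> (nat \<times> nat \<Rightarrow> int) \<Rightarrow> bit) \<Rightarrow> bit" where
  "alternations s = chain_sum 0 (\<lambda>\<sigma>. \<Prod>i<N. s i (\<sigma> i) + s i (\<sigma> (Suc i)))"

text \<open>Two labels with the same \<open>t e\<close> differ by an invariant function
  \<open>h\<close>, so their cocycles differ by the coboundary of a function on the quotient, which
  the cup product does not see.\<close>

lemma alternations_upd:
  assumes s: "\<And>i. label (t i) (s i)" and s': "label (t e) s'" and e: "e < N"
  shows "alternations (s(e := s')) = alternations s"
proof -
  define h where "h v = s e v + s' v" for v
  have h: "label (\<lambda>_. 0) h"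
    unfolding label_def
  proof (intro ballI allI)
    fix v S assume "v \<in> verts"
    then have "s e (flip S v) = s e v + t e S" "s' (flip S v) = s' v + t e S"
      using s[of e] s' by (auto simp: label_def)
    then show "h (flip S v) = h v + 0" by (cases "t e S") (auto simp: h_def)
  qed
  have hi: "flip_inv (\<lambda>\<sigma>. h (\<sigma> i))" if "i \<le> N" for i
    using h that unfolding flip_inv_def label_def by (simp add: chains_def)
  let ?L = "\<lambda>\<sigma>. \<Prod>i<e. s i (\<sigma> i) + s i (\<sigma> (Suc i))"
  let ?R = "\<lambda>\<sigma>. \<Prod>i\<in>{Suc e..<N}. s i (\<sigma> i) + s i (\<sigma> (Suc i))"
  have L: "flip_inv ?L" and R: "flip_inv ?R"
    using e by (intro flip_inv_prod flip_inv_edge[OF s]; simp)+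
  \<comment> \<open>The tail \<open>h (\<sigma> (Suc e)) * R\<close> ignores the vertices up to
    \<open>e\<close>; the head \<open>L * h (\<sigma> e)\<close> ignores those after
    \<open>e\<close>.\<close>
  have low: "chain_sum 0 (\<lambda>\<sigma>. ?L \<sigma> * (h (\<sigma> (Suc e)) * ?R \<sigma>)) = 0"
    using e by (intro chain_sum_low[OF s] flip_inv_mult hi R) (auto simp: indep_of_def)
  have high: "chain_sum 0 (\<lambda>\<sigma>. (?L \<sigma> * h (\<sigma> e)) * ?R \<sigma>) = 0"
    using e by (intro chain_sum_high[OF s] flip_inv_mult hi L) (auto simp: indep_of_def)
  have split: "(\<Prod>i<N. f i) = (\<Prod>i<e. f i) * f e * (\<Prod>i\<in>{Suc e..<N}. f i)" for f :: "nat \<Rightarrow> bit"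
  proof -
    have "{..<N} = {..<Suc e} \<union> {Suc e..<N}" using e by auto
    then show ?thesis by (simp add: prod.union_disjoint ivl_disj_int)
  qed
  have "alternations (s(e := s')) + alternations s =
      chain_sum 0 (\<lambda>\<sigma>. ?L \<sigma> * (s' (\<sigma> e) + s' (\<sigma> (Suc e))) * ?R \<sigma> +
        ?L \<sigma> * (s e (\<sigma> e) + s e (\<sigma> (Suc e))) * ?R \<sigma>)"
    unfolding alternations_def split chain_sum_add by simp
  also have "\<dots> = chain_sum 0 (\<lambda>\<sigma>. ?L \<sigma> * (h (\<sigma> (Suc e)) * ?R \<sigma>) + (?L \<sigma> * h (\<sigma> e)) * ?R \<sigma>)"
    unfolding h_def by (simp only: algebra_simps)
  also have "\<dots> = 0"
    unfolding chain_sum_add low high by simp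
  finally show ?thesis
    by (cases "alternations s"; cases "alternations (s(e := s'))") auto
qed

lemma alternations_eq:
  assumes s: "\<And>i. label (t i) (s i)" and s': "\<And>i. label (t i) (s' i)"
  shows "alternations s = alternations s'"
proof -
  have "alternations (\<lambda>i. if i < n then s' i else s i) = alternations s" if "n \<le> N" for n
    using that
  proof (induction n)
    case (Suc n)
    have "(\<lambda>i. if i < Suc n then s' i else s i) = (\<lambda>i. if i < n then s' i else s i)(n := s' n)"
      by (auto simp: fun_eq_iff less_Suc_eq)
    then show ?case
      using alternations_upd[of t "\<lambda>i. if i < n then s' i else s i" n "s' n"] s s' Suc by auto
  qed simp
  from this[of N] have "alternations s = alternations (\<lambda>i. if i < N then s' i else s i)" by simp
  also have "\<dots> = alternations s'"
    unfolding alternations_def by (intro chain_sum_cong prod.cong) auto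
  finally show ?thesis .
qed

section \<open>Evaluation for the standard labels\<close>

text \<open>A step produces an odd entry, so no nonzero coordinate vanishes and
  \<open>top_coord\<close> cannot drop. If it stays, the sign of the coordinate stays as
  well.\<close>

lemma step_top_coord:
  assumes "step v w" "v \<in> verts" "w \<in> verts" "a < m"
  shows "top_coord a v + of_bool (sign_bit a v \<noteq> sign_bit a w) \<le> top_coord a w"
proof -
  obtain i y where i: "even (v i)" "\<bar>y - v i\<bar> = 1" "w = v(i := y)"
    using assms(1) unfolding step_def by blast
  have "odd y" using i by presburger
  then have nz: "v j \<noteq> 0 \<Longrightarrow> w j \<noteq> 0" for j using i by auto
  let ?r = "top_coord a v"
  have le: "?r \<le> top_coord a w"
    using nz top_coord[OF assms(2,4)] top_coord[OF assms(3,4)] by blast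
  have "sign_bit a v = sign_bit a w" if eq: "?r = top_coord a w"
  proof (cases "i = (a, ?r)")
    case True
    then have "v i \<noteq> 0" using top_coord(2)[OF assms(2,4)] by simp
    \<comment> \<open>A nonzero even entry has absolute value at least 2, so a change by 1 cannot
      cross zero.\<close>
    then have "v i \<le> -2 \<or> v i \<ge> 2" using i(1) by presburger
    then have "v i < 0 \<longleftrightarrow> y < 0" using i(2) by linarith
    moreover have "w (a, ?r) = y" "v (a, ?r) = v i" using True i(3) by auto
    ultimately show ?thesis unfolding sign_bit_def eq[symmetric] by simp
  next
    case False
    then have "w (a, ?r) = v (a, ?r)" using i(3) by auto
    then show ?thesis unfolding sign_bit_def eq[symmetric] by simp
  qed
  then show ?thesis using le by (cases "?r = top_coord a w") auto
qed

text \<open>A label change of \<open>sign_bit a\<close> along a chain strictly raises \<open>top_coord a\<close>, which is at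
  most \<open>p a\<close>. Hence all steps are used up, each step changes exactly one sign, and comparing the sums
  of the indices of these signs with the sum of the maxima \<open>tp e\<close> forces sign \<open>tp e\<close> to change at
  step \<open>e\<close>. Exactly one chain remains.\<close>

lemma alternations_standard:
  assumes tp: "\<And>e. e < N \<Longrightarrow> tp e \<in> \<kappa> e" "\<And>e b. e < N \<Longrightarrow> b \<in> \<kappa> e \<Longrightarrow> b \<le> tp e"
    and \<kappa>: "\<And>e. \<kappa> e \<subseteq> {..<m}"
    and cnt: "\<And>a. a < m \<Longrightarrow> card {e. e < N \<and> tp e = a} = p a"
  shows "alternations (\<lambda>e v. \<Sum>a\<in>\<kappa> e. sign_bit a v) = 1"
proof -
  define s where "s e v = (\<Sum>a\<in>\<kappa> e. sign_bit a v)" for e v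
  define cnt where "cnt a e = card {e'. e' < e \<and> tp e' = a}" for a e
  \<comment> \<open>The surviving chain: coordinate 0 of each block stays at the peak
    \<open>M\<close>, and step \<open>e\<close> opens the next coordinate of block
    \<open>tp e\<close> with sign opposite to the last one. The guard \<open>e \<le> N\<close>
    matches the zero value that \<open>chains\<close> prescribes beyond \<open>N\<close>.\<close>
  define \<tau> :: "nat \<Rightarrow> nat \<times> nat \<Rightarrow> int" where
    "\<tau> e = (\<lambda>(a, r). if e \<le> N \<and> a < m \<and> r \<le> cnt a e then (if r = 0 then M else (-1) ^ r) else 0)" for e
  have M2: "M \<ge> 2" using M_even M_pos by presburger
  have cnt_0: "cnt a 0 = 0" for a by (simp add: cnt_def)
  have cnt_Suc: "cnt a (Suc e) = cnt a e + of_bool (tp e = a)" for a e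
  proof -
    have "{e'. e' < Suc e \<and> tp e' = a} =
        (if tp e = a then insert e {e'. e' < e \<and> tp e' = a} else {e'. e' < e \<and> tp e' = a})"
      by (auto simp: less_Suc_eq)
    then show ?thesis by (simp add: cnt_def)
  qed
  have cnt_N: "cnt a N = p a" if "a < m" for a
    using assms(4) that by (simp add: cnt_def)
  have cnt_le: "cnt a e \<le> p a" if "a < m" "e \<le> N" for a e
  proof -
    have "cnt a e \<le> cnt a N" unfolding cnt_def using that by (intro card_mono) auto
    then show ?thesis using cnt_N that by simp
  qed
  have topm: "tp e < m" if "e < N" for e using tp(1)[OF that] \<kappa> by blast
  have finchi: "finite (\<kappa> e)" for e using \<kappa> finite_subset by blast
  have \<tau>_verts: "\<tau> e \<in> verts" if e: "e \<le> N" for e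
  proof -
    have "\<tau> e i = 0" if "i \<notin> idx" for i
      using that cnt_le[OF _ e] by (cases i) (auto simp: \<tau>_def idx_def dest: order_trans)
    moreover have "\<bar>\<tau> e i\<bar> \<le> M" for i
      using M2 by (cases i) (auto simp: \<tau>_def power_abs)
    moreover have "\<exists>r\<le>p a. \<bar>\<tau> e (a, r)\<bar> = M" if "a < m" for a
      using that e M2 by (intro exI[of _ 0]) (auto simp: \<tau>_def)
    ultimately show ?thesis unfolding verts_def by blast
  qed
  have \<tau>_Suc: "\<tau> (Suc e) = (\<tau> e)((tp e, Suc (cnt (tp e) e)) := (-1) ^ Suc (cnt (tp e) e))" if "e < N" for e
    using that topm[OF that] by (auto simp: \<tau>_def cnt_Suc fun_eq_iff le_Suc_eq of_bool_def split: if_splits)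
  have \<tau>_step: "step (\<tau> e) (\<tau> (Suc e))" if "e < N" for e
    unfolding step_def \<tau>_Suc[OF that]
    by (intro exI[of _ "(tp e, Suc (cnt (tp e) e))"] exI[of _ "(-1) ^ Suc (cnt (tp e) e)"])
      (simp add: \<tau>_def power_abs)
  have \<tau>_chains: "\<tau> \<in> chains"
    unfolding chains_def using \<tau>_verts \<tau>_step M_even
    by (auto simp: \<tau>_def cnt_0 fun_eq_iff split: prod.splits)
  have \<tau>_top: "top_coord a (\<tau> e) = cnt a e" if "a < m" "e \<le> N" for a e
  proof (rule antisym)
    show "top_coord a (\<tau> e) \<le> cnt a e"
      using top_coord(2)[OF \<tau>_verts[OF that(2)] that(1)] by (auto simp: \<tau>_def split: if_splits)
    show "cnt a e \<le> top_coord a (\<tau> e)"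
      using top_coord(3)[OF \<tau>_verts[OF that(2)] that(1), of "cnt a e"] cnt_le[OF that] that M2
      by (auto simp: \<tau>_def)
  qed
  have \<tau>_sg: "sign_bit a (\<tau> e) = of_bool (odd (cnt a e))" if "a < m" "e \<le> N" for a e
    unfolding sign_bit_def \<tau>_top[OF that] using that M2 by (auto simp: \<tau>_def)
  have \<tau>_flip: "s e (\<tau> e) + s e (\<tau> (Suc e)) = 1" if e: "e < N" for e
  proof -
    have "s e (\<tau> e) + s e (\<tau> (Suc e)) = (\<Sum>a\<in>\<kappa> e. of_bool (a = tp e))"
      unfolding s_def sum.distrib[symmetric]
    proof (rule sum.cong)
      fix a assume "a \<in> \<kappa> e"
      then have "a < m" using \<kappa> by blast
      then show "sign_bit a (\<tau> e) + sign_bit a (\<tau> (Suc e)) = of_bool (a = tp e)"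
        using e by (auto simp: \<tau>_sg cnt_Suc)
    qed simp
    also have "\<dots> = 1" using tp(1)[OF e] finchi by (simp add: of_bool_def)
    finally show ?thesis .
  qed
  have unique: "\<sigma> = \<tau>" if \<sigma>: "\<sigma> \<in> chains" "\<forall>a<m. sign_bit a (\<sigma> 0) = 0"
    and fl: "\<And>e. e < N \<Longrightarrow> s e (\<sigma> e) + s e (\<sigma> (Suc e)) = 1" for \<sigma>
  proof -
    have V: "\<sigma> i \<in> verts" if "i \<le> N" for i using \<sigma> that by (simp add: chains_def)
    have S: "step (\<sigma> i) (\<sigma> (Suc i))" if "i < N" for i using \<sigma> that by (simp add: chains_def)
    have "\<exists>a\<in>\<kappa> e. sign_bit a (\<sigma> e) \<noteq> sign_bit a (\<sigma> (Suc e))" if "e < N" for e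
    proof (rule ccontr)
      assume "\<not> ?thesis"
      then have "s e (\<sigma> e) = s e (\<sigma> (Suc e))" unfolding s_def by (intro sum.cong) auto
      then show False using fl[OF that] by simp
    qed
    then obtain \<alpha> where \<alpha>: "\<And>e. e < N \<Longrightarrow> \<alpha> e \<in> \<kappa> e \<and> sign_bit (\<alpha> e) (\<sigma> e) \<noteq> sign_bit (\<alpha> e) (\<sigma> (Suc e))"
      by metis
    have \<alpha>m: "\<alpha> e < m" if "e < N" for e using \<alpha>[OF that] \<kappa> by blast
    define c where "c a e = card {e'. e' < e \<and> \<alpha> e' = a}" for a e
    have c_Suc: "c a (Suc e) = c a e + of_bool (\<alpha> e = a)" for a e
    proof -
      have "{e'. e' < Suc e \<and> \<alpha> e' = a} =
          (if \<alpha> e = a then insert e {e'. e' < e \<and> \<alpha> e' = a} else {e'. e' < e \<and> \<alpha> e' = a})"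
        by (auto simp: less_Suc_eq)
      then show ?thesis by (simp add: c_def)
    qed
    have mono: "top_coord a (\<sigma> e) + c a e' \<le> top_coord a (\<sigma> e') + c a e"
      if "a < m" "e \<le> e'" "e' \<le> N" for a e e'
      using that(2,3)
    proof (induction e' rule: dec_induct)
      case (step e')
      have "top_coord a (\<sigma> e') + of_bool (\<alpha> e' = a) \<le> top_coord a (\<sigma> (Suc e'))"
        using step_top_coord[OF S V V, of e' a] \<alpha>[of e'] step.prems that(1) by (auto split: if_splits)
      then show ?case using step by (simp add: c_Suc)
    qed simp
    have c_le: "c a N \<le> p a" if "a < m" for a
      using mono[OF that, of 0 N] top_coord(1)[OF V[of N] that] by (simp add: c_def)
    have "(\<Sum>a<m. c a N) = (\<Sum>e<N. 1)"
      unfolding c_def using \<alpha>m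
      by (subst sum.group[symmetric, of "{..<N}" "{..<m}" \<alpha>]) (auto simp: Collect_conj_eq lessThan_def intro!: sum.cong)
    then have "(\<Sum>a<m. c a N) = (\<Sum>a<m. p a)" by (simp add: N_def)
    then have c_eq: "c a N = p a" if "a < m" for a
      using sum_mono_inv[of "\<lambda>a. c a N" "{..<m}" p a] c_le that by auto
    \<comment> \<open>Grouping by value: such a sum depends only on how often each block occurs, so
      \<open>\<alpha>\<close> and \<open>tp\<close> have equal sums, and
      \<open>\<alpha> e \<le> tp e\<close> forces equality.\<close>
    have wsum: "(\<Sum>e<N. f e) = (\<Sum>a<m. a * card {e. e < N \<and> f e = a})" if "\<And>e. e < N \<Longrightarrow> f e < m" for f
      using that
      by (subst sum.group[symmetric, of "{..<N}" "{..<m}" f]) (auto simp: Collect_conj_eq lessThan_def intro!: sum.cong)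
    have "(\<Sum>e<N. \<alpha> e) = (\<Sum>a<m. a * card {e. e < N \<and> \<alpha> e = a})"
      using \<alpha>m by (rule wsum)
    also have "\<dots> = (\<Sum>a<m. a * card {e. e < N \<and> tp e = a})"
      using c_eq cnt_N by (intro sum.cong) (auto simp: c_def cnt_def)
    also have "\<dots> = (\<Sum>e<N. tp e)"
      using topm by (rule wsum[symmetric])
    finally have "(\<Sum>e<N. \<alpha> e) = (\<Sum>e<N. tp e)" .
    then have \<alpha>_top: "\<alpha> e = tp e" if "e < N" for e
      using sum_mono_inv[of \<alpha> "{..<N}" tp e] \<alpha> tp(2) that by auto
    have c_cnt: "c a e = cnt a e" if "e \<le> N" for a e
      unfolding c_def cnt_def using \<alpha>_top that by (intro arg_cong[where f = card]) auto
    \<comment> \<open>Growth from \<open>e\<close> to \<open>N\<close> gives the upper bound, growth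
      from \<open>0\<close> to \<open>e\<close> the lower one.\<close>
    have tc: "top_coord a (\<sigma> e) = cnt a e" if a: "a < m" and e: "e \<le> N" for a e
    proof (rule antisym)
      show "top_coord a (\<sigma> e) \<le> cnt a e"
        using mono[OF a e] top_coord(1)[OF V[of N] a] c_cnt e cnt_N[OF a] by simp
      show "cnt a e \<le> top_coord a (\<sigma> e)"
        using mono[OF a _ e, of 0] c_cnt e cnt_0 by simp
    qed
    \<comment> \<open>At the start only coordinate 0 of each block is nonzero, and the zero sign bit
      makes it \<open>M\<close>. Then the rise of \<open>top_coord\<close> dictates which coordinate
      opens and the sign change dictates its value.\<close>
    have "\<sigma> e = \<tau> e" if "e \<le> N" for e
      using that
    proof (induction e)
      case 0
      show ?case
      proof
        fix i :: "nat \<times> nat"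
        obtain a r where i: "i = (a, r)" by (cases i)
        show "\<sigma> 0 i = \<tau> 0 i"
        proof (cases "a < m \<and> r \<le> p a")
          case False
          then have "i \<notin> idx" by (auto simp: i idx_def)
          then show ?thesis using V[of 0] \<tau>_verts[of 0] by (simp add: verts_def)
        next
          case True
          then have zero: "\<sigma> 0 (a, q) = 0" if "q \<le> p a" "q \<noteq> 0" for q
            using top_coord(3)[OF V[of 0], of a q] tc[of a 0] that by (auto simp: cnt_0)
          obtain q where "q \<le> p a" "\<bar>\<sigma> 0 (a, q)\<bar> = M" using verts_peak[OF V[of 0], of a] True by auto
          then have "\<bar>\<sigma> 0 (a, 0)\<bar> = M" using zero[of q] M_pos by (cases "q = 0") auto
          moreover have "\<not> \<sigma> 0 (a, 0) < 0" using \<sigma>(2) True tc[of a 0] by (auto simp: sign_bit_def cnt_0)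
          ultimately have "\<sigma> 0 (a, 0) = M" by simp
          then show ?thesis using True zero[of r] by (auto simp: i \<tau>_def cnt_0)
        qed
      qed
    next
      case (Suc e)
      then have e: "e < N" and IH: "\<sigma> e = \<tau> e" by simp_all
      let ?b = "tp e" let ?r = "Suc (cnt (tp e) e)"
      have b: "?b < m" using topm e .
      obtain i y where i: "even (\<sigma> e i)" "\<bar>y - \<sigma> e i\<bar> = 1" "\<sigma> (Suc e) = (\<sigma> e)(i := y)"
        using S[OF e] unfolding step_def by blast
      have tS: "top_coord ?b (\<sigma> (Suc e)) = ?r" using tc[OF b, of "Suc e"] e by (simp add: cnt_Suc)
      then have "\<sigma> (Suc e) (?b, ?r) \<noteq> 0" using top_coord(2)[OF V[of "Suc e"] b] e by simp
      moreover have v0: "\<sigma> e (?b, ?r) = 0" unfolding IH by (simp add: \<tau>_def)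
      ultimately have ib: "i = (?b, ?r)" using i(3) by (metis fun_upd_apply)
      then have y: "\<bar>y\<bar> = 1" using i v0 by simp
      have "sign_bit ?b (\<sigma> (Suc e)) \<noteq> sign_bit ?b (\<tau> e)" using \<alpha>[OF e] \<alpha>_top[OF e] IH by metis
      moreover have "sign_bit ?b (\<sigma> (Suc e)) = of_bool (y < 0)" unfolding sign_bit_def tS using i(3) ib by simp
      ultimately have "y < 0 \<longleftrightarrow> odd ?r" using \<tau>_sg[OF b, of e] e by (auto split: if_splits)
      then have "y = (-1) ^ ?r" using y by (cases "even ?r") auto
      then show ?case using \<tau>_Suc[OF e] i(3) ib IH by simp
    qed
    moreover have "\<sigma> e = \<tau> e" if "e > N" for e
      using \<sigma>(1) that by (auto simp: chains_def \<tau>_def fun_eq_iff)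
    ultimately have "\<sigma> e = \<tau> e" for e by (cases "e \<le> N") auto
    then show ?thesis ..
  qed
  have "alternations s = (\<Sum>\<sigma>\<in>{\<sigma> \<in> chains. \<forall>a<m. sign_bit a (\<sigma> 0) = 0}. of_bool (\<sigma> = \<tau>))"
    unfolding alternations_def chain_sum_def
  proof (rule sum.cong)
    fix \<sigma> assume \<sigma>: "\<sigma> \<in> {\<sigma> \<in> chains. \<forall>a<m. sign_bit a (\<sigma> 0) = 0}"
    show "(\<Prod>i<N. s i (\<sigma> i) + s i (\<sigma> (Suc i))) = of_bool (\<sigma> = \<tau>)"
    proof (cases "\<sigma> = \<tau>")
      case True
      then show ?thesis using \<tau>_flip by simp
    next
      case False
      then obtain e where "e < N" "s e (\<sigma> e) + s e (\<sigma> (Suc e)) \<noteq> 1" using unique[of \<sigma>] \<sigma> by blast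
      then show ?thesis using False by (auto intro!: prod_zero bexI[of _ e])
    qed
  qed simp
  also have "\<dots> = 1"
    using \<tau>_chains \<tau>_sg finite_chains by (simp add: of_bool_def cnt_0)
  finally show ?thesis by (simp add: s_def[abs_def])
qed

text \<open>The given signs have the equivariance of the standard labels, so their alternation count
  is 1 too, and a nonzero sum has a nonzero term.\<close>

theorem alternating_chain:
  fixes s :: "nat \<Rightarrow> (nat \<times> nat \<Rightarrow> int) \<Rightarrow> bit"
  assumes tp: "\<And>e. e < N \<Longrightarrow> tp e \<in> \<kappa> e" "\<And>e b. e < N \<Longrightarrow> b \<in> \<kappa> e \<Longrightarrow> b \<le> tp e"
    and \<kappa>: "\<And>e. e < N \<Longrightarrow> \<kappa> e \<subseteq> {..<m}"
    and cnt: "\<And>a. a < m \<Longrightarrow> card {e. e < N \<and> tp e = a} = p a"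
    and s: "\<And>e v S. e < N \<Longrightarrow> v \<in> verts \<Longrightarrow> s e (flip S v) = s e v + (\<Sum>a\<in>\<kappa> e. of_bool (a \<in> S))"
  obtains \<sigma> where "\<sigma> \<in> chains" "\<And>e. e < N \<Longrightarrow> s e (\<sigma> e) \<noteq> s e (\<sigma> (Suc e))"
proof -
  \<comment> \<open>\<open>alternations_eq\<close> wants labels at every index; from
    \<open>N\<close> on they are made trivial.\<close>
  define \<kappa>' where "\<kappa>' e = (if e < N then \<kappa> e else {})" for e
  define s' where "s' e = (if e < N then s e else (\<lambda>_. 0))" for e
  define t where "t e S = (\<Sum>a\<in>\<kappa>' e. of_bool (a \<in> S) :: bit)" for e S
  have "alternations s' = alternations (\<lambda>e v. \<Sum>a\<in>\<kappa>' e. sign_bit a v)"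
  proof (rule alternations_eq)
    show "label (t e) (s' e)" for e
      using s by (auto simp: label_def s'_def t_def \<kappa>'_def)
    have "\<kappa>' e \<subseteq> {..<m}" for e using \<kappa> by (simp add: \<kappa>'_def)
    then show "label (t e) (\<lambda>v. \<Sum>a\<in>\<kappa>' e. sign_bit a v)" for e
      unfolding label_def t_def sum.distrib[symmetric]
      by (intro ballI allI sum.cong) (auto simp: sign_bit_flip subset_eq)
  qed
  also have "\<dots> = 1"
  proof (rule alternations_standard[where tp = tp])
    show "\<kappa>' e \<subseteq> {..<m}" for e using \<kappa> by (simp add: \<kappa>'_def)
  qed (use tp cnt in \<open>simp_all add: \<kappa>'_def\<close>)
  finally have "(\<Sum>\<sigma>\<in>{\<sigma> \<in> chains. \<forall>a<m. sign_bit a (\<sigma> 0) = 0}. \<Prod>i<N. s' i (\<sigma> i) + s' i (\<sigma> (Suc i))) \<noteq> 0"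
    by (simp add: alternations_def chain_sum_def)
  then obtain \<sigma> where "\<sigma> \<in> {\<sigma> \<in> chains. \<forall>a<m. sign_bit a (\<sigma> 0) = 0}"
      "(\<Prod>i<N. s' i (\<sigma> i) + s' i (\<sigma> (Suc i))) \<noteq> 0"
    by (rule sum.not_neutral_contains_not_neutral)
  then have \<sigma>: "\<sigma> \<in> chains" "(\<Prod>i<N. s' i (\<sigma> i) + s' i (\<sigma> (Suc i))) \<noteq> 0"
    by simp_all
  have "s e (\<sigma> e) \<noteq> s e (\<sigma> (Suc e))" if "e < N" for e
  proof
    assume "s e (\<sigma> e) = s e (\<sigma> (Suc e))"
    then have "s' e (\<sigma> e) + s' e (\<sigma> (Suc e)) = 0" using that by (simp add: s'_def)
    then have "(\<Prod>i<N. s' i (\<sigma> i) + s' i (\<sigma> (Suc i))) = 0"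
      using that by (intro prod_zero) auto
    then show False using \<sigma>(2) by simp
  qed
  then show ?thesis using \<sigma>(1) that by blast
qed

end

section \<open>Common zeros on a product of spheres\<close>

definition cube_spheres :: "nat \<Rightarrow> (nat \<Rightarrow> nat) \<Rightarrow> (nat \<times> nat \<Rightarrow> real) set" where
  "cube_spheres m p = {x. (\<forall>i. i \<notin> (SIGMA a:{..<m}. {..p a}) \<longrightarrow> x i = 0) \<and> (\<forall>i. \<bar>x i\<bar> \<le> 1) \<and>
     (\<forall>a<m. \<exists>r\<le>p a. \<bar>x (a, r)\<bar> = 1)}"

definition negate :: "nat \<Rightarrow> (nat \<times> nat \<Rightarrow> real) \<Rightarrow> nat \<times> nat \<Rightarrow> real" where
  "negate a x = (\<lambda>i. if fst i = a then - x i else x i)"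

lemma (in grid) scaled_verts:
  assumes "v \<in> verts"
  shows "(\<lambda>i. real_of_int (v i) / real_of_int M) \<in> cube_spheres m p"
proof -
  have abs: "\<bar>real_of_int (v i) / real_of_int M\<bar> = real_of_int \<bar>v i\<bar> / real_of_int M" for i
    using M_pos by simp
  have "\<bar>real_of_int (v i) / real_of_int M\<bar> \<le> 1" for i
    unfolding abs using verts_abs_le[OF assms, of i] M_pos by (simp only: divide_le_eq_1 of_int_le_iff) simp
  moreover have "\<exists>r\<le>p a. \<bar>real_of_int (v (a, r)) / real_of_int M\<bar> = 1" if am: "a < m" for a
  proof -
    obtain r where "r \<le> p a" "\<bar>v (a, r)\<bar> = M" using verts_peak[OF assms am] by blast
    then show ?thesis unfolding abs using M_pos by (intro exI[of _ r]) simp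
  qed
  moreover have "real_of_int (v i) / real_of_int M = 0" if "i \<notin> (SIGMA a:{..<m}. {..p a})" for i
    using assms that by (simp add: verts_def idx_def)
  ultimately show ?thesis unfolding cube_spheres_def by blast
qed

lemma tendsto_fun_iff:
  fixes X :: "'c \<Rightarrow> 'a \<Rightarrow> 'b::topological_space"
  shows "(X \<longlongrightarrow> x) F \<longleftrightarrow> (\<forall>i. ((\<lambda>n. X n i) \<longlongrightarrow> x i) F)"
  using limitin_componentwise[of "\<lambda>_. euclidean" UNIV X x F]
  by (simp add: euclidean_product_topology)

text \<open>Tychonoff for the product of all intervals; the remaining conditions are closed, the
  peak condition because its union over \<open>r\<close> is finite.\<close>

lemma compact_cube_spheres: "compact (cube_spheres m p)"
proof -
  have "compactin (product_topology (\<lambda>_. euclidean) UNIV) (PiE UNIV (\<lambda>_ :: nat \<times> nat. {-1..1 :: real}))"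
    unfolding compactin_PiE by simp
  then have 1: "compact (PiE UNIV (\<lambda>_ :: nat \<times> nat. {-1..1 :: real}))"
    by (simp add: euclidean_product_topology)
  have eq: "cube_spheres m p = PiE UNIV (\<lambda>_. {-1..1}) \<inter>
      ((\<Inter>i\<in>-(SIGMA a:{..<m}. {..p a}). {x. x i = 0}) \<inter> (\<Inter>a\<in>{..<m}. \<Union>r\<in>{..p a}. {x. \<bar>x (a, r)\<bar> = 1}))"
    by (auto simp: cube_spheres_def PiE_def Pi_def abs_le_iff; smt (verit))
  have "closed {x :: nat \<times> nat \<Rightarrow> real. x i = 0}" for i
    by (intro closed_Collect_eq continuous_intros continuous_on_product_coordinates)
  moreover have "closed {x :: nat \<times> nat \<Rightarrow> real. \<bar>x i\<bar> = 1}" for i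
    by (intro closed_Collect_eq continuous_intros continuous_on_product_coordinates)
  ultimately show ?thesis
    unfolding eq by (intro compact_Int_closed 1 closed_Int closed_INT closed_UN ballI) auto
qed

text \<open>In the mod 2 cohomology of a product of projective spaces, \<open>f a r\<close> has the
  class \<open>x_a\<close> plus generators of earlier factors. The top monomial arises exactly once:
  the last generator must be taken from all of its own functions, then the one before it, and so
  on.\<close>

theorem cube_spheres_common_zero:
  fixes f :: "nat \<Rightarrow> nat \<Rightarrow> (nat \<times> nat \<Rightarrow> real) \<Rightarrow> real"
  assumes cont: "\<And>a r. a < m \<Longrightarrow> r < p a \<Longrightarrow> continuous_on (cube_spheres m p) (f a r)"
    and \<kappa>: "\<And>a r. a < m \<Longrightarrow> r < p a \<Longrightarrow> a \<in> \<kappa> a r \<and> \<kappa> a r \<subseteq> {..a}"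
    and odd: "\<And>a r b x. a < m \<Longrightarrow> r < p a \<Longrightarrow> b < m \<Longrightarrow> x \<in> cube_spheres m p \<Longrightarrow>
      f a r (negate b x) = (if b \<in> \<kappa> a r then - f a r x else f a r x)"
  obtains x where "x \<in> cube_spheres m p" "\<And>a r. a < m \<Longrightarrow> r < p a \<Longrightarrow> f a r x = 0"
proof -
  define C where "C = cube_spheres m p"
  define N where "N = (\<Sum>a<m. p a)"
  have NN: "grid.N m p = N"
  proof -
    have "grid 2" by unfold_locales auto
    then show ?thesis by (simp add: N_def grid.N_def)
  qed
  let ?Q = "SIGMA a:{..<m}. {..<p a}"
  obtain g where g: "bij_betw g {..<N} ?Q"
    using ex_bij_betw_nat_finite[of ?Q] by (auto simp: N_def atLeast0LessThan)
  have gQ: "fst (g e) < m" "snd (g e) < p (fst (g e))" if "e < N" for e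
    using bij_betwE[OF g] that by force+
  define F where "F e = f (fst (g e)) (snd (g e))" for e
  define X where "X e = \<kappa> (fst (g e)) (snd (g e))" for e
  have F_cont: "continuous_on C (F e)" if "e < N" for e
    unfolding F_def C_def using gQ[OF that] by (intro cont) auto
  have X: "fst (g e) \<in> X e" "X e \<subseteq> {..fst (g e)}" if "e < N" for e
    unfolding X_def using \<kappa> gQ[OF that] by auto
  then have Xm: "X e \<subseteq> {..<m}" if "e < N" for e
    using gQ[OF that] that by fastforce
  have Xfin: "finite (X e)" if "e < N" for e
    using Xm[OF that] finite_subset by blast
  have F_odd: "F e (negate b x) = (if b \<in> X e then - F e x else F e x)"
    if "e < N" "b < m" "x \<in> C" for e b x
    using odd[OF gQ[OF that(1)] that(2)] that(3) by (simp add: F_def X_def C_def)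
  \<comment> \<open>Composing single negations, the sign is the parity of the number of blocks in
    both \<open>X e\<close> and \<open>S\<close>, written as a sum of bits.\<close>
  have F_flip: "F e (\<lambda>i. if fst i \<in> S then - x i else x i) =
      (if (\<Sum>a\<in>X e. of_bool (a \<in> S)) = (0 :: bit) then F e x else - F e x)"
    (is "F e (?fl S x) = ?rhs S")
    if e: "e < N" and x: "x \<in> C" and S: "finite S" "S \<subseteq> {..<m}" for e x S
    using S
  proof (induction S)
    case (insert b S)
    have fl: "?fl (insert b S) x = negate b (?fl S x)"
      using insert by (auto simp: negate_def fun_eq_iff)
    have "?fl S x \<in> C" using x by (auto simp: C_def cube_spheres_def)
    then have "F e (?fl (insert b S) x) = (if b \<in> X e then - F e (?fl S x) else F e (?fl S x))"
      unfolding fl using F_odd[OF e, of b] insert by auto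
    moreover have "(\<Sum>a\<in>X e. of_bool (a \<in> insert b S) :: bit) =
        (\<Sum>a\<in>X e. of_bool (a \<in> S) + of_bool (a = b))"
      using insert by (intro sum.cong) auto
    then have "(\<Sum>a\<in>X e. of_bool (a \<in> insert b S) :: bit) =
        (\<Sum>a\<in>X e. of_bool (a \<in> S)) + of_bool (b \<in> X e)"
      using Xfin[OF e] by (simp add: sum.distrib of_bool_def)
    ultimately show ?case
      using insert by (cases "\<Sum>a\<in>X e. of_bool (a \<in> S) :: bit") auto
  qed simp
  have img: "g ` {..<N} = ?Q" and inj: "inj_on g {..<N}"
    using g by (simp_all add: bij_betw_def)
  have card: "card {e. e < N \<and> fst (g e) = a} = p a" if "a < m" for a
  proof -
    have "g ` {e. e < N \<and> fst (g e) = a} = {y \<in> g ` {..<N}. fst y = a}"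
      by (auto simp only: image_iff lessThan_iff mem_Collect_eq)
    also have "\<dots> = {a} \<times> {..<p a}" unfolding img using that by auto
    finally have "card ({a} \<times> {..<p a}) = card (g ` {e. e < N \<and> fst (g e) = a})" by simp
    also have "\<dots> = card {e. e < N \<and> fst (g e) = a}"
      by (intro card_image inj_on_subset[OF inj]) auto
    finally show ?thesis by (simp add: card_cartesian_product)
  qed
  \<comment> \<open>Even and positive as the grid demands, and unbounded, so the mesh tends to
    zero.\<close>
  define M :: "nat \<Rightarrow> int" where "M n = 2 * (int n + 1)" for n
  define sc :: "nat \<Rightarrow> (nat \<times> nat \<Rightarrow> int) \<Rightarrow> nat \<times> nat \<Rightarrow> real" where
    "sc n v = (\<lambda>i. of_int (v i) / of_int (M n))" for n v
  have "\<exists>\<sigma>. \<sigma> \<in> grid.chains m p (M n) \<and> (\<forall>e<N. F e (sc n (\<sigma> e)) * F e (sc n (\<sigma> (Suc e))) \<le> 0)" for n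
  proof -
    interpret grid m p "M n" by unfold_locales (auto simp: M_def)
    have scC: "sc n v \<in> C" if "v \<in> verts" for v
      using scaled_verts[OF that] unfolding C_def sc_def .
    have sc_flip: "sc n (flip S v) = (\<lambda>i. if fst i \<in> S \<inter> {..<m} then - sc n v i else sc n v i)"
      if "v \<in> verts" for S v
    proof
      fix i
      have "i \<notin> idx \<Longrightarrow> v i = 0" using that by (simp add: verts_def)
      moreover have "i \<in> idx \<Longrightarrow> fst i < m" by (auto simp: idx_def)
      ultimately have "fst i < m \<or> v i = 0" by blast
      then show "sc n (flip S v) i = (if fst i \<in> S \<inter> {..<m} then - sc n v i else sc n v i)"
        by (auto simp only: sc_def flip_def of_int_minus minus_divide_left if_True if_False Int_iff lessThan_iff of_int_0 div_0 minus_zero split: if_splits)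
    qed
    \<comment> \<open>At zeros of \<open>F e\<close> the standard label stands in, which keeps the
      equivariance; where labels differ, the product of the values is still at most 0.\<close>
    define s where "s e v = (if F e (sc n v) > 0 then 0 else if F e (sc n v) < 0 then 1 else
        (\<Sum>a\<in>X e. sign_bit a v))" for e v
    have lab: "s e (flip S v) = s e v + (\<Sum>a\<in>X e. of_bool (a \<in> S))" if e: "e < N" and v: "v \<in> verts" for e v S
    proof -
      have "(\<Sum>a\<in>X e. sign_bit a (flip S v)) = (\<Sum>a\<in>X e. sign_bit a v) + (\<Sum>a\<in>X e. of_bool (a \<in> S))"
        unfolding sum.distrib[symmetric] using Xm[OF e] v by (intro sum.cong) (auto simp: sign_bit_flip)
      moreover have "(\<Sum>a\<in>X e. of_bool (a \<in> S) :: bit) = (\<Sum>a\<in>X e. of_bool (a \<in> S \<inter> {..<m}))"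
        using Xm[OF e] by (intro sum.cong) auto
      then have "F e (sc n (flip S v)) = (if (\<Sum>a\<in>X e. of_bool (a \<in> S)) = (0 :: bit) then F e (sc n v) else - F e (sc n v))"
        unfolding sc_flip[OF v] using F_flip[OF e scC[OF v], of "S \<inter> {..<m}"] by simp
      ultimately show ?thesis
        by (cases "\<Sum>a\<in>X e. of_bool (a \<in> S) :: bit") (auto simp: s_def)
    qed
    obtain \<sigma> where \<sigma>: "\<sigma> \<in> chains" "\<And>e. e < N \<Longrightarrow> s e (\<sigma> e) \<noteq> s e (\<sigma> (Suc e))"
      using alternating_chain[of "\<lambda>e. fst (g e)" X s, unfolded NN, OF _ _ Xm card lab] X by blast
    have "F e (sc n (\<sigma> e)) * F e (sc n (\<sigma> (Suc e))) \<le> 0" if "e < N" for e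
      using \<sigma>(2)[OF that] by (auto simp: s_def mult_le_0_iff split: if_splits)
    then show ?thesis using \<sigma>(1) by blast
  qed
  then obtain \<sigma> where \<sigma>: "\<And>n. \<sigma> n \<in> grid.chains m p (M n)"
      and prod: "\<And>n e. e < N \<Longrightarrow> F e (sc n (\<sigma> n e)) * F e (sc n (\<sigma> n (Suc e))) \<le> 0"
    by metis
  have inC: "sc n (\<sigma> n e) \<in> C" if "e \<le> N" for n e
  proof -
    interpret grid m p "M n" by unfold_locales (auto simp: M_def)
    have "\<sigma> n e \<in> verts" using \<sigma>[of n] that by (simp add: chains_def NN)
    then show ?thesis
      using scaled_verts unfolding C_def sc_def by blast
  qed
  \<comment> \<open>A step moves a coordinate by at most 1, so after scaling all vertices of a chain
    share the limit of the first.\<close>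
  have close: "\<bar>\<sigma> n e i - \<sigma> n 0 i\<bar> \<le> int e" if "e \<le> N" for n e i
    using that
  proof (induction e)
    case (Suc e)
    interpret grid m p "M n" by unfold_locales (auto simp: M_def)
    have "step (\<sigma> n e) (\<sigma> n (Suc e))" using \<sigma>[of n] Suc.prems by (simp add: chains_def NN)
    then have "\<bar>\<sigma> n (Suc e) i - \<sigma> n e i\<bar> \<le> 1" by (auto simp: step_def)
    then show ?case using Suc by simp
  qed simp
  obtain x r where x: "x \<in> C" and r: "strict_mono r" and lim0: "(\<lambda>n. sc (r n) (\<sigma> (r n) 0)) \<longlonglongrightarrow> x"
  proof -
    have "seq_compact C" using compact_cube_spheres[of m p] by (simp add: C_def compact_eq_seq_compact_metric)
    moreover have "\<forall>n. sc n (\<sigma> n 0) \<in> C" using inC by simp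
    ultimately obtain l r where "l \<in> C" "strict_mono r" "((\<lambda>n. sc n (\<sigma> n 0)) \<circ> r) \<longlonglongrightarrow> l"
      by (rule seq_compactE)
    then show ?thesis using that by (simp add: o_def)
  qed
  have lim: "(\<lambda>n. sc (r n) (\<sigma> (r n) e)) \<longlonglongrightarrow> x" if e: "e \<le> N" for e
    unfolding tendsto_fun_iff
  proof
    fix i
    have "(\<lambda>n. real e / real (Suc n)) \<longlonglongrightarrow> 0"
      by (rule LIMSEQ_Suc[OF lim_const_over_n])
    then have L: "(\<lambda>n. real e / real (Suc (r n))) \<longlonglongrightarrow> 0"
      using LIMSEQ_subseq_LIMSEQ[OF _ r] by (auto simp only: o_def)
    have B: "norm (sc (r n) (\<sigma> (r n) e) i - sc (r n) (\<sigma> (r n) 0) i) \<le> real e / real (Suc (r n))" for n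
    proof -
      have "\<bar>real_of_int (\<sigma> (r n) e i - \<sigma> (r n) 0 i)\<bar> \<le> real e"
        using close[OF e, of "r n" i] by linarith
      then have "\<bar>real_of_int (\<sigma> (r n) e i - \<sigma> (r n) 0 i)\<bar> / real_of_int (M (r n)) \<le> real e / real (Suc (r n))"
        by (intro frac_le) (auto simp: M_def)
      then show ?thesis
        by (simp add: sc_def M_def diff_divide_distrib[symmetric])
    qed
    have D: "(\<lambda>n. sc (r n) (\<sigma> (r n) e) i - sc (r n) (\<sigma> (r n) 0) i) \<longlonglongrightarrow> 0"
      using always_eventually[OF allI[OF B]] L by (rule Lim_null_comparison)
    have "(\<lambda>n. sc (r n) (\<sigma> (r n) 0) i) \<longlonglongrightarrow> x i"
      using lim0 unfolding tendsto_fun_iff by blast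
    from tendsto_add[OF D this] show "(\<lambda>n. sc (r n) (\<sigma> (r n) e) i) \<longlonglongrightarrow> x i"
      by (simp only: diff_add_cancel add_0)
  qed
  have F0: "F e x = 0" if e: "e < N" for e
  proof -
    have *: "(\<lambda>n. F e (sc (r n) (\<sigma> (r n) e'))) \<longlonglongrightarrow> F e x" if "e' \<le> N" for e'
      using continuous_on_tendsto_compose[OF F_cont[OF e] lim[OF that] x] inC[OF that] by simp
    have "(\<lambda>n. F e (sc (r n) (\<sigma> (r n) e)) * F e (sc (r n) (\<sigma> (r n) (Suc e)))) \<longlonglongrightarrow> F e x * F e x"
      using e by (intro tendsto_mult *) auto
    then have "F e x * F e x \<le> 0"
      by (rule LIMSEQ_le_const2) (use prod[OF e] in auto)
    then show ?thesis by (metis mult_le_0_iff order_antisym)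
  qed
  have "f a r x = 0" if "a < m" "r < p a" for a r
  proof -
    have "(a, r) \<in> g ` {..<N}" using g that by (auto simp: bij_betw_def)
    then obtain e where "e < N" "g e = (a, r)" by auto
    then show ?thesis using F0[of e] by (simp add: F_def)
  qed
  then show ?thesis using that x by (simp add: C_def)
qed

section \<open>Flats meeting images of disjoint faces\<close>

text \<open>Where \<open>S\<close> vanishes, boundedness of \<open>\<psi>\<close> makes the product
  tend to 0, whatever the quotient does.\<close>

lemma continuous_on_cone:
  fixes \<psi> :: "'b::real_normed_vector \<Rightarrow> 'a::real_normed_vector"
    and P :: "'t::topological_space \<Rightarrow> 'b"
  assumes \<psi>: "continuous_on UNIV \<psi>" and B: "\<And>y. norm (\<psi> y) \<le> B"
    and S: "continuous_on C S" and P: "continuous_on C P"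
  shows "continuous_on C (\<lambda>x. S x *\<^sub>R \<psi> (P x /\<^sub>R S x))"
  unfolding continuous_on_def
proof
  fix x assume x: "x \<in> C"
  have Sx: "(S \<longlongrightarrow> S x) (at x within C)" and Px: "(P \<longlongrightarrow> P x) (at x within C)"
    using S P x by (auto simp: continuous_on_def)
  show "((\<lambda>x. S x *\<^sub>R \<psi> (P x /\<^sub>R S x)) \<longlongrightarrow> S x *\<^sub>R \<psi> (P x /\<^sub>R S x)) (at x within C)"
  proof (cases "S x = 0")
    case True
    have "((\<lambda>y. \<bar>S y\<bar> * B) \<longlongrightarrow> \<bar>S x\<bar> * B) (at x within C)"
      by (intro tendsto_intros Sx)
    then have L: "((\<lambda>y. \<bar>S y\<bar> * B) \<longlongrightarrow> 0) (at x within C)" using True by simp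
    have "norm (S y *\<^sub>R \<psi> (P y /\<^sub>R S y)) \<le> \<bar>S y\<bar> * B" for y
      by (simp add: mult_left_mono B)
    from always_eventually[OF allI[OF this]] L
    have "((\<lambda>x. S x *\<^sub>R \<psi> (P x /\<^sub>R S x)) \<longlongrightarrow> 0) (at x within C)"
      by (rule Lim_null_comparison)
    then show ?thesis using True by simp
  next
    case False
    have "isCont \<psi> (P x /\<^sub>R S x)"
      using \<psi> by (simp add: continuous_on_eq_continuous_at)
    then show ?thesis
      using False by (intro tendsto_intros Sx Px isCont_tendsto_compose[of _ \<psi>])
  qed
qed

text \<open>Keeping only the indices of positive weight is what will put the two points into
  disjoint faces.\<close>

lemma weighted_mean_in_convex_hull:
  fixes e :: "nat \<Rightarrow> 'b::real_vector"
  assumes w: "\<And>l. l \<in> L \<Longrightarrow> 0 \<le> w l" and "finite L" and W: "(\<Sum>l\<in>L. w l) \<noteq> 0"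
  shows "(\<Sum>l\<in>L. w l *\<^sub>R e l) /\<^sub>R (\<Sum>l\<in>L. w l) \<in> convex hull (e ` {l \<in> L. w l > 0})"
proof -
  let ?J = "{l \<in> L. w l > 0}" and ?W = "\<Sum>l\<in>L. w l"
  have "?W > 0" using W sum_nonneg[of L w] w by force
  have zero: "\<forall>l\<in>L - ?J. w l = 0"
    using w by force
  have J: "(\<Sum>l\<in>L. w l) = (\<Sum>l\<in>?J. w l)"
    using \<open>finite L\<close> by (rule sum.mono_neutral_right) (blast, rule zero)
  have J': "(\<Sum>l\<in>L. w l *\<^sub>R e l) = (\<Sum>l\<in>?J. w l *\<^sub>R e l)"
    using \<open>finite L\<close> by (rule sum.mono_neutral_right) (blast, metis zero scaleR_zero_left)
  have "(\<Sum>l\<in>?J. (w l / ?W) *\<^sub>R e l) \<in> convex hull (e ` ?J)"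
  proof (rule convex_sum)
    show "(\<Sum>l\<in>?J. w l / ?W) = 1"
      using W by (simp add: sum_divide_distrib[symmetric] J[symmetric])
    show "\<And>l. l \<in> ?J \<Longrightarrow> 0 \<le> w l / ?W" using \<open>?W > 0\<close> by simp
    show "\<And>l. l \<in> ?J \<Longrightarrow> e l \<in> convex hull (e ` ?J)" by (simp add: hull_inc)
  qed (use \<open>finite L\<close> in auto)
  then show ?thesis
    unfolding J' scaleR_sum_right scaleR_scaleR by (simp only: divide_inverse mult.commute)
qed

text \<open>Nonzero pairwise orthogonal vectors are independent, so the solution set is the
  translate by \<open>y0\<close> of an orthogonal complement of dimension \<open>k\<close>.\<close>

lemma affine_flat_orthogonal:
  fixes U :: "nat \<Rightarrow> 'a::euclidean_space"
  assumes "\<And>a. a < n \<Longrightarrow> U a \<noteq> 0" "\<And>a b. a < n \<Longrightarrow> b < a \<Longrightarrow> U a \<bullet> U b = 0"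
    and "DIM('a) = n + k"
  shows "affine_flat k {y. \<forall>a<n. U a \<bullet> y = U a \<bullet> y0}"
proof -
  let ?A = "U ` {..<n}" and ?W = "{y. \<forall>x\<in>U ` {..<n}. orthogonal x y}"
  have orth: "U a \<bullet> U b = 0" if "a < n" "b < n" "a \<noteq> b" for a b
    using assms(2)[of a b] assms(2)[of b a] that by (cases "b < a") (auto simp: inner_commute)
  have inj: "inj_on U {..<n}"
  proof (rule inj_onI)
    fix a b assume "a \<in> {..<n}" "b \<in> {..<n}" "U a = U b"
    then show "a = b" using orth[of a b] assms(1)[of b] by auto
  qed
  have "independent ?A"
    using assms(1) orth by (intro pairwise_orthogonal_independent) (auto simp: pairwise_def orthogonal_def)
  then have "dim ?A = n"
    using inj by (simp add: dim_eq_card_independent card_image)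
  moreover have W: "?W = {y. \<forall>x\<in>span ?A. orthogonal x y}"
    by (auto simp: orthogonal_commute intro: orthogonal_to_span span_base)
  have "dim {y \<in> UNIV. \<forall>x \<in> span ?A. orthogonal x y} + dim (span ?A) = dim (UNIV :: 'a set)"
    by (intro dim_subspace_orthogonal_to_vectors) auto
  ultimately have dimW: "dim ?W = k"
    using assms(3) unfolding W by (simp add: dim_UNIV)
  have sub: "subspace ?W"
    by (auto simp: subspace_def orthogonal_clauses)
  have eq: "{y. \<forall>a<n. U a \<bullet> y = U a \<bullet> y0} = (+) y0 ` ?W"
  proof (intro set_eqI iffI)
    fix y assume "y \<in> {y. \<forall>a<n. U a \<bullet> y = U a \<bullet> y0}"
    then have "y - y0 \<in> ?W" by (auto simp: orthogonal_def inner_diff_right)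
    then show "y \<in> (+) y0 ` ?W" by (rule rev_image_eqI) simp
  qed (auto simp: orthogonal_def inner_add_right)
  show ?thesis
    unfolding affine_flat_def eq using sub dimW
    by (simp add: aff_dim_translation_eq aff_dim_subspace subspace_imp_affine affine_translation[symmetric])
qed

text \<open>Disjointness is recorded on vertex indices, where it is the disjointness of positive and
  negative coordinates; affine independence transfers it to faces.\<close>

theorem radon_transversal:
  fixes \<phi> :: "nat \<Rightarrow> 'b::euclidean_space \<Rightarrow> 'a::euclidean_space" and e :: "nat \<Rightarrow> nat \<Rightarrow> 'b"
  assumes dim: "DIM('a) = n + k"
    and cont: "\<And>i. i \<le> k \<Longrightarrow> continuous_on (convex hull (e i ` {..Suc n})) (\<phi> i)"
  obtains F J K where "affine_flat k F"
    "\<And>i. i \<le> k \<Longrightarrow> J i \<subseteq> {..Suc n} \<and> K i \<subseteq> {..Suc n} \<and> J i \<inter> K i = {}"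
    "\<And>i. i \<le> k \<Longrightarrow> F \<inter> \<phi> i ` (convex hull (e i ` J i)) \<noteq> {}"
    "\<And>i. i \<le> k \<Longrightarrow> F \<inter> \<phi> i ` (convex hull (e i ` K i)) \<noteq> {}"
proof -
  obtain b :: "nat \<Rightarrow> 'a" where b: "bij_betw b {..<n + k} Basis"
    using ex_bij_betw_nat_finite[of "Basis :: 'a set"] unfolding dim[symmetric] atLeast0LessThan by auto
  define \<Delta> where "\<Delta> i = convex hull (e i ` {..Suc n})" for i
  have \<Delta>: "convex (\<Delta> i)" "compact (\<Delta> i)" "closed (\<Delta> i)" "\<Delta> i \<noteq> {}" for i
    unfolding \<Delta>_def by (simp_all add: compact_convex_hull finite_imp_compact compact_imp_closed)
  \<comment> \<open>Retracting to the simplex first gives a bounded continuous map on the whole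
    space, as \<open>continuous_on_cone\<close> requires.\<close>
  define \<psi> where "\<psi> i = \<phi> i \<circ> closest_point (\<Delta> i)" for i
  have cp: "closest_point (\<Delta> i) y \<in> \<Delta> i" for i y
    using \<Delta>(3,4) by (rule closest_point_in_set)
  have \<psi>_eq: "\<psi> i y = \<phi> i y" if "y \<in> \<Delta> i" for i y
    using that by (simp add: \<psi>_def closest_point_self)
  have \<psi>_cont: "continuous_on UNIV (\<psi> i)" if "i \<le> k" for i
    unfolding \<psi>_def
    by (intro continuous_on_compose continuous_on_closest_point \<Delta>
        continuous_on_subset[OF cont[OF that]]) (use cp in \<open>auto simp: \<Delta>_def\<close>)
  have "\<exists>B. \<forall>y. norm (\<psi> i y) \<le> B" if "i \<le> k" for i
  proof -
    have "bounded (\<phi> i ` \<Delta> i)"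
      using compact_continuous_image[OF cont[OF that]] \<Delta>(2)[of i] unfolding \<Delta>_def
      by (blast intro: compact_imp_bounded)
    then obtain B where "\<forall>z\<in>\<phi> i ` \<Delta> i. norm z \<le> B" by (auto simp: bounded_iff)
    then show ?thesis using cp unfolding \<psi>_def o_def by blast
  qed
  then obtain B where B: "norm (\<psi> i y) \<le> B i" if "i \<le> k" for i y by metis
  define m where "m = n + Suc k"
  \<comment> \<open>Block \<open>a < n\<close> holds the \<open>k + a + 1\<close> coefficients of
    \<open>U a\<close>; block \<open>n + i\<close> holds the \<open>n + 2\<close> coordinates of the
    deleted join of simplex \<open>i\<close>.\<close>
  define p where "p a = (if a < n then k + a else Suc n)" for a
  define C where "C = cube_spheres m p"
  define U where "U a x = (\<Sum>c\<le>k + a. x (a, c) *\<^sub>R b c)" for a and x :: "nat \<times> nat \<Rightarrow> real"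
  define S where "S s i x = (\<Sum>l\<le>Suc n. max 0 (s * x (n + i, l)))" for s i and x :: "nat \<times> nat \<Rightarrow> real"
  define P where "P s i x = (\<Sum>l\<le>Suc n. max 0 (s * x (n + i, l)) *\<^sub>R e i l)" for s i and x :: "nat \<times> nat \<Rightarrow> real"
  define G where "G s i x = S s i x *\<^sub>R \<psi> i (P s i x /\<^sub>R S s i x)" for s i x
  \<comment> \<open>Comparing different simplices needs a quantity unchanged when the two points of
    a simplex are exchanged, hence this symmetric mean.\<close>
  define A where "A i x = (G 1 i x + G (-1) i x) /\<^sub>R (S 1 i x + S (-1) i x)" for i x
  \<comment> \<open>\<open>P\<close> and \<open>S\<close> parametrise the deleted join of the simplex by the boundary of a cube: the positive
    and the negative part of the coordinate vector are unnormalised barycentric coordinates. Scaling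
    by \<open>S\<close> in \<open>G\<close> keeps the junk value \<open>\<psi> i 0\<close> at \<open>S = 0\<close> from destroying continuity.\<close>
  define f where "f a r x =
    (if a < n then (if r < k then U a x \<bullet> (A (Suc r) x - A 0 x) else U a x \<bullet> U (r - k) x)
     else (if r < n then U r x \<bullet> (G 1 (a - n) x - G (-1) (a - n) x) else (\<Sum>l\<le>Suc n. x (a, l))))" for a r x
  define \<kappa> where "\<kappa> a r = (if a < n then (if r < k then {a} else {a, r - k}) else if r < n then {a, r} else {a})" for a r
  have coord: "continuous_on C (\<lambda>x. x i)" for i
    by (rule continuous_on_subset[OF continuous_on_product_coordinates subset_UNIV])
  have U_cont: "continuous_on C (U a)" for a
    unfolding U_def by (intro continuous_on_sum continuous_on_scaleR continuous_on_const coord)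
  have S_cont: "continuous_on C (S s i)" for s i
    unfolding S_def
    by (intro continuous_on_sum continuous_on_max continuous_on_mult continuous_on_const coord)
  have P_cont: "continuous_on C (P s i)" for s i
    unfolding P_def
    by (intro continuous_on_sum continuous_on_scaleR continuous_on_max continuous_on_mult continuous_on_const coord)
  have G_cont: "continuous_on C (G s i)" if "i \<le> k" for s i
    unfolding G_def by (rule continuous_on_cone[OF \<psi>_cont[OF that] B[OF that] S_cont P_cont])
  have S_nonneg: "0 \<le> S s i x" for s i x
    unfolding S_def by (intro sum_nonneg) simp
  have S_pos: "0 < S 1 i x + S (-1) i x" if x: "x \<in> C" and i: "i \<le> k" for i x
  proof -
    have "n + i < m" using i by (simp add: m_def)
    then obtain l where l: "l \<le> Suc n" "\<bar>x (n + i, l)\<bar> = 1"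
      using x unfolding C_def cube_spheres_def p_def by force
    have "S 1 i x + S (-1) i x = (\<Sum>l\<le>Suc n. \<bar>x (n + i, l)\<bar>)"
      unfolding S_def sum.distrib[symmetric] by (intro sum.cong) auto
    also have "\<dots> \<ge> \<bar>x (n + i, l)\<bar>" using l by (intro member_le_sum) auto
    finally show ?thesis using l by linarith
  qed
  have A_cont: "continuous_on C (A i)" if "i \<le> k" for i
    unfolding A_def using S_pos[OF _ that]
    by (intro continuous_on_scaleR continuous_on_inverse continuous_on_add G_cont S_cont that) force
  have U_neg: "U a (negate c x) = (if c = a then - U a x else U a x)" for a c x
    unfolding U_def negate_def by (simp add: sum_negf)
  have S_neg: "S s i (negate c x) = S (if c = n + i then - s else s) i x" for s i c x
    unfolding S_def negate_def by simp
  have P_neg: "P s i (negate c x) = P (if c = n + i then - s else s) i x" for s i c x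
    unfolding P_def negate_def by simp
  have G_neg: "G s i (negate c x) = G (if c = n + i then - s else s) i x" for s i c x
    unfolding G_def S_neg P_neg ..
  have A_neg: "A i (negate c x) = A i x" for i c x
    unfolding A_def S_neg G_neg by (simp add: add.commute)
  obtain x where x: "x \<in> C" and zero: "\<And>a r. a < m \<Longrightarrow> r < p a \<Longrightarrow> f a r x = 0"
  proof (rule cube_spheres_common_zero[of m p f \<kappa>])
    fix a r assume ar: "a < m" "r < p a"
    show "continuous_on (cube_spheres m p) (f a r)"
    proof -
      have "continuous_on C (f a r)"
        unfolding f_def using ar
        by (cases "a < n"; cases "r < k"; cases "r < n")
          (auto simp: p_def m_def intro!: continuous_on_inner continuous_on_diff continuous_on_add continuous_on_sum
              U_cont A_cont G_cont coord)
      then show ?thesis by (simp add: C_def)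
    qed
    show "a \<in> \<kappa> a r \<and> \<kappa> a r \<subseteq> {..a}"
      using ar by (auto simp: \<kappa>_def p_def)
    show "f a r (negate c x) = (if c \<in> \<kappa> a r then - f a r x else f a r x)" for c x
    proof -
      have "(\<Sum>l\<le>Suc n. negate c x (a, l)) = (if c = a then - (\<Sum>l\<le>Suc n. x (a, l)) else (\<Sum>l\<le>Suc n. x (a, l)))"
        by (simp add: negate_def sum_negf)
      then show ?thesis
        using ar unfolding f_def \<kappa>_def U_neg A_neg G_neg
        by (cases "a < n"; cases "r < k"; cases "r < n") (auto simp: p_def inner_diff_right)
    qed
  qed (use that in \<open>simp add: C_def\<close>)
  have U_nz: "U a x \<noteq> 0" if a: "a < n" for a
  proof -
    have "a < m" using a by (simp add: m_def)
    then obtain c where c: "c \<le> k + a" "\<bar>x (a, c)\<bar> = 1"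
      using x a unfolding C_def cube_spheres_def p_def by force
    have inB: "b c' \<in> Basis" if "c' \<le> k + a" for c'
      using bij_betwE[OF b] that a by simp
    have ortho: "b c' \<bullet> b c = (if c' = c then 1 else 0)" if "c' \<le> k + a" for c'
    proof -
      have "b c' = b c \<longleftrightarrow> c' = c"
        using b that c(1) a by (auto simp: bij_betw_def inj_on_def)
      then show ?thesis using inB[OF that] inB[OF c(1)] by (simp add: inner_Basis)
    qed
    have "U a x \<bullet> b c = (\<Sum>c'\<le>k + a. if c' = c then x (a, c) else 0)"
      unfolding U_def inner_sum_left using ortho by (intro sum.cong) auto
    also have "\<dots> = x (a, c)" using c(1) by simp
    finally show ?thesis using c(2) by auto
  qed
  have U_orth: "U a x \<bullet> U c x = 0" if "a < n" "c < a" for a c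
    using zero[of a "k + c"] that by (simp add: f_def p_def m_def)
  define y where "y s i = P s i x /\<^sub>R S s i x" for s i
  \<comment> \<open>A vanishing coordinate sum says that positive and negative parts have equal
    mass, so both points exist and the factors in \<open>G\<close> cancel.\<close>
  have S_eq: "S (-1) i x = S 1 i x" "0 < S 1 i x" if i: "i \<le> k" for i
  proof -
    have "S 1 i x - S (-1) i x = (\<Sum>l\<le>Suc n. x (n + i, l))"
      unfolding S_def sum_subtractf[symmetric] by (intro sum.cong) auto
    also have "\<dots> = 0"
      using zero[of "n + i" n] i by (simp add: f_def p_def m_def)
    finally show "S (-1) i x = S 1 i x" by simp
    then show "0 < S 1 i x" using S_pos[OF x i] by simp
  qed
  have same: "U a x \<bullet> \<psi> i (y (-1) i) = U a x \<bullet> \<psi> i (y 1 i)" if a: "a < n" and i: "i \<le> k" for a i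
  proof -
    have "U a x \<bullet> (G 1 i x - G (-1) i x) = 0"
      using zero[of "n + i" a] a i by (simp add: f_def p_def m_def)
    then have "S 1 i x * (U a x \<bullet> \<psi> i (y 1 i) - U a x \<bullet> \<psi> i (y (-1) i)) = 0"
      unfolding G_def y_def S_eq(1)[OF i] by (simp add: inner_diff_right right_diff_distrib)
    then show ?thesis using S_eq(2)[OF i] by simp
  qed
  \<comment> \<open>Both points now have the same product with \<open>U a\<close>, so their mean has
    it too, and comparing means compares the points.\<close>
  have UA: "U a x \<bullet> A i x = U a x \<bullet> \<psi> i (y 1 i)" if a: "a < n" and i: "i \<le> k" for a i
  proof -
    have G: "U a x \<bullet> G 1 i x = S 1 i x * (U a x \<bullet> \<psi> i (y 1 i))"
        "U a x \<bullet> G (-1) i x = S 1 i x * (U a x \<bullet> \<psi> i (y 1 i))"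
      using same[OF a i] by (simp_all only: G_def y_def S_eq(1)[OF i] inner_scaleR_right)
    have "U a x \<bullet> A i x = (U a x \<bullet> G 1 i x + U a x \<bullet> G (-1) i x) / (S 1 i x + S (-1) i x)"
      by (simp only: A_def inner_scaleR_right inner_add_right divide_inverse mult.commute)
    also have "\<dots> = U a x \<bullet> \<psi> i (y 1 i)"
      unfolding G S_eq(1)[OF i] using S_eq(2)[OF i] by (simp only: field_simps) simp
    finally show ?thesis .
  qed
  define y0 where "y0 = \<psi> 0 (y 1 0)"
  have Uy0: "U a x \<bullet> \<psi> i (y 1 i) = U a x \<bullet> y0" if a: "a < n" and i: "i \<le> k" for a i
  proof (cases i)
    case (Suc r)
    then have "U a x \<bullet> A i x = U a x \<bullet> A 0 x"
      using zero[of a r] a i by (simp add: f_def p_def m_def inner_diff_right)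
    then show ?thesis using UA[OF a i] UA[OF a, of 0] by (simp add: y0_def)
  qed (simp add: y0_def)
  define F where "F = {z. \<forall>a<n. U a x \<bullet> z = U a x \<bullet> y0}"
  define J where "J s i = {l \<in> {..Suc n}. max 0 (s * x (n + i, l)) > 0}" for s i
  have y_hull: "y s i \<in> convex hull (e i ` J s i)" if "S s i x \<noteq> 0" for s i
    unfolding y_def P_def S_def J_def
    using that unfolding S_def by (intro weighted_mean_in_convex_hull) auto
  have J_sub: "J s i \<subseteq> {..Suc n}" for s i by (auto simp: J_def)
  have y_\<Delta>: "y s i \<in> \<Delta> i" if "S s i x \<noteq> 0" for s i
    using y_hull[OF that] hull_mono[OF image_mono[OF J_sub], of convex "e i" s i] by (auto simp: \<Delta>_def)
  show ?thesis
  proof (rule that[of F "J 1" "J (-1)"])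
    show "affine_flat k F"
      unfolding F_def by (rule affine_flat_orthogonal[OF U_nz U_orth dim])
    fix i assume i: "i \<le> k"
    have "J 1 i \<inter> J (-1) i = {}" by (auto simp: J_def)
    then show "J 1 i \<subseteq> {..Suc n} \<and> J (-1) i \<subseteq> {..Suc n} \<and> J 1 i \<inter> J (-1) i = {}"
      using J_sub by blast
    have nz: "S 1 i x \<noteq> 0" "S (-1) i x \<noteq> 0" using S_eq[OF i] by auto
    have "\<phi> i (y 1 i) \<in> F"
      using Uy0 i unfolding F_def \<psi>_eq[OF y_\<Delta>[OF nz(1)], symmetric] by simp
    then show "F \<inter> \<phi> i ` (convex hull (e i ` J 1 i)) \<noteq> {}" using y_hull[OF nz(1)] by blast
    have "\<phi> i (y (-1) i) \<in> F"
      using Uy0 same i unfolding F_def \<psi>_eq[OF y_\<Delta>[OF nz(2)], symmetric] by simp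
    then show "F \<inter> \<phi> i ` (convex hull (e i ` J (-1) i)) \<noteq> {}" using y_hull[OF nz(2)] by blast
  qed
qed

theorem theorem2p2:
  fixes d k :: nat
    and e :: "nat \<Rightarrow> nat \<Rightarrow> 'b::euclidean_space"
    and \<Delta> :: "nat \<Rightarrow> 'b set"
    and \<phi> :: "nat \<Rightarrow> 'b \<Rightarrow> real ^ 'n"
  assumes "d = CARD('n)"
    and "k < d"
    and "\<And>i. i \<in> {0..k} \<Longrightarrow> simplex_with_vertices (d - k + 1) (e i) (\<Delta> i)"
    and "\<And>i. i \<in> {0..k} \<Longrightarrow> continuous_on (\<Delta> i) (\<phi> i)"
  shows "\<exists>F :: (real ^ 'n) set. affine_flat k F \<and>
           (\<forall>i\<in>{0..k}. \<exists>\<tau>1 \<tau>2.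
              face_of_simplex (d - k + 1) (e i) \<tau>1 \<and>
              face_of_simplex (d - k + 1) (e i) \<tau>2 \<and>
              \<tau>1 \<inter> \<tau>2 = {} \<and>
              F \<inter> \<phi> i ` \<tau>1 \<noteq> {} \<and>
              F \<inter> \<phi> i ` \<tau>2 \<noteq> {})"
proof -
  let ?n = "d - k"
  have simplex: "inj_on (e i) {..Suc ?n}" "\<not> affine_dependent (e i ` {..Suc ?n})"
      "\<Delta> i = convex hull (e i ` {..Suc ?n})" if "i \<le> k" for i
    using assms(3)[of i] that by (auto simp: simplex_with_vertices_def atLeast0AtMost)
  have "DIM(real ^ 'n) = ?n + k" using assms(1,2) by simp
  moreover have "continuous_on (convex hull (e i ` {..Suc ?n})) (\<phi> i)" if "i \<le> k" for i
    using assms(4)[of i] simplex(3)[OF that] that by simp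
  ultimately obtain F J K where F: "affine_flat k F"
    and JK: "\<And>i. i \<le> k \<Longrightarrow> J i \<subseteq> {..Suc ?n} \<and> K i \<subseteq> {..Suc ?n} \<and> J i \<inter> K i = {}"
    and FJ: "\<And>i. i \<le> k \<Longrightarrow> F \<inter> \<phi> i ` (convex hull (e i ` J i)) \<noteq> {}"
    and FK: "\<And>i. i \<le> k \<Longrightarrow> F \<inter> \<phi> i ` (convex hull (e i ` K i)) \<noteq> {}"
    using radon_transversal[of ?n k e \<phi>] by blast
  \<comment> \<open>Meeting \<open>F\<close> forces the hull, and hence \<open>L\<close>, to be
    nonempty.\<close>
  have face: "face_of_simplex (?n + 1) (e i) (convex hull (e i ` L))"
    if "L \<subseteq> {..Suc ?n}" "F \<inter> \<phi> i ` (convex hull (e i ` L)) \<noteq> {}" for i L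
    unfolding face_of_simplex_def using that by (intro exI[of _ L]) auto
  \<comment> \<open>Disjoint subsets of an affinely independent set have disjoint affine
    hulls.\<close>
  have disj: "convex hull (e i ` J i) \<inter> convex hull (e i ` K i) = {}" if i: "i \<le> k" for i
  proof -
    have "e i ` J i \<inter> e i ` K i = e i ` (J i \<inter> K i)"
      using simplex(1)[OF i] JK[OF i] by (metis inj_on_image_Int)
    then have "affine hull (e i ` J i) \<inter> affine hull (e i ` K i) = {}"
      using JK[OF i] by (intro disjoint_affine_hull[OF simplex(2)[OF i]]) auto
    then show ?thesis
      using convex_hull_subset_affine_hull by blast
  qed
  show ?thesis
  proof (intro exI[of _ F] conjI ballI F)
    fix i assume "i \<in> {0..k}"
    then have i: "i \<le> k" by simp
    show "\<exists>\<tau>1 \<tau>2. face_of_simplex (?n + 1) (e i) \<tau>1 \<and> face_of_simplex (?n + 1) (e i) \<tau>2 \<and>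
        \<tau>1 \<inter> \<tau>2 = {} \<and> F \<inter> \<phi> i ` \<tau>1 \<noteq> {} \<and> F \<inter> \<phi> i ` \<tau>2 \<noteq> {}"
      using face[OF _ FJ[OF i]] face[OF _ FK[OF i]] JK[OF i] FJ[OF i] FK[OF i] disj[OF i]
      by (intro exI[of _ "convex hull (e i ` J i)"] exI[of _ "convex hull (e i ` K i)"] conjI) auto
  qed
qed

end
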